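(* Let $(M,g,\pi)$ be an asymptotically flat initial data set. In addition, suppose that in the asymptotically flat coordinates $\pi$ satisfies $$\pi=\bar{\pi}\, r^{-p}+\pi^{(-3)}r^{-3}+o_1(r^{-3}),$$ where $\frac32<p<3$ and $\bar\pi$ and $\pi^{(-3)}$ are symmetric $(0,2)$-tensors that are independent of $r$ on the unit sphere $S^2$ (i.e. their components in the coordinates $\{x^i\}$ are functions of $x/|x|\in S^2$ only). Assume further that $|J|=O(r^{-4-\epsilon})$ for some $\epsilon>0$, where $J=\mathrm{div}_g\pi$ is the current density. Then the ADM angular momentum is always finite; that is, for each rotation vector field $Y=\frac{\partial}{\partial x^i}\times\vec x$, $i=1,2,3$, the limit $$J(Y)=\frac{1}{8\pi}\lim_{r\to\infty}\int_{|x|=r}\sum_{j,k}\pi_{jk}Y^j\frac{x^k}{|x|}\,d\sigma_0$$ exists and is finite.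
   Context: An initial data set is a three-dimensional manifold $M$ with a Riemannian metric $g$ and a symmetric $(0,2)$-tensor $k$; the conjugate momentum is $\pi=k-(\mathrm{tr}_g k)g$, so that $k=\pi-\frac12(\mathrm{tr}_g\pi)g$, and one writes the data as $(M,g,\pi)$. The mass density $\mu$ and current density $J$ are $2\mu=R_g-|\pi|_g^2+\frac12(\mathrm{tr}_g\pi)^2$ and $J=\mathrm{div}_g\pi$ (equivalently $\mu=\frac12(R_g-|k|_g^2+(\mathrm{tr}_gk)^2)$, $J=\mathrm{div}_gk-d(\mathrm{tr}_gk)$). Given $q>\frac12$, $p>\frac32$, $\epsilon>0$, the data set is asymptotically flat if for some compact $K\subset M$, $M\setminus K$ has finitely many components (ends), each diffeomorphic to the complement of a compact set in $\mathbb R^3$, and under these diffeomorphisms $g_{ij}-\delta_{ij}=O_2(r^{-q})$, $k_{ij}=O_1(r^{-p})$, $\mu=O(r^{-3-\epsilon})$, $|J|=O(r^{-3-\epsilon})$. Here $r=|x|$, and the subscript in $O_l$ and $o_l$ is the number of derivatives with the corresponding decay: e.g. $f=O_1(r^a)$ means $|f|=O(r^a)$, $|\nabla f|=O(r^{a-1})$, and similarly for $o_1$. The quantities are computed in each end. $d\sigma_0$ is the area measure of the standard sphere of radius $r$. The symbol $\pi$ in the prefactor $\frac1{8\pi}$ is the usual number. *)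

theory Defs
  imports "HOL-Analysis.Analysis" "HOL-Library.Landau_Symbols"
begin

definition partial :: "3 \<Rightarrow> (real^3 \<Rightarrow> real) \<Rightarrow> real^3 \<Rightarrow> real" where
  "partial i f x = frechet_derivative f (at x) (axis i 1)"

text \<open>For open \<open>U\<close>, \<open>Ck_on l f U\<close> says that \<open>f\<close> is of class \<open>C\<^sup>l\<close> on \<open>U\<close>; values of \<open>f\<close> outside
  \<open>U\<close> are irrelevant.\<close>

primrec Ck_on :: "nat \<Rightarrow> (real^3 \<Rightarrow> real) \<Rightarrow> (real^3) set \<Rightarrow> bool" where
  "Ck_on 0 f U \<longleftrightarrow> continuous_on U f"
| "Ck_on (Suc l) f U \<longleftrightarrow> (\<forall>x\<in>U. f differentiable (at x)) \<and> (\<forall>i. Ck_on l (partial i f) U)"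

definition smooth_on :: "(real^3 \<Rightarrow> real) \<Rightarrow> (real^3) set \<Rightarrow> bool" where
  "smooth_on f U \<longleftrightarrow> (\<forall>l. Ck_on l f U)"

text \<open>A chart is a pair of a domain \<open>U\<close> and a coordinate map, whose values matter only on \<open>U\<close>.\<close>

type_synonym 'a chart = "'a set \<times> ('a \<Rightarrow> real^3)"

definition is_chart :: "'a topology \<Rightarrow> 'a chart \<Rightarrow> bool" where
  "is_chart M c \<longleftrightarrow> openin M (fst c) \<and> open (snd c ` fst c) \<and>
     homeomorphic_map (subtopology M (fst c)) (top_of_set (snd c ` fst c)) (snd c)"

definition overlap :: "'a chart \<Rightarrow> 'a chart \<Rightarrow> (real^3) set" where
  "overlap c d = snd c ` (fst c \<inter> fst d)"

definition transition :: "'a chart \<Rightarrow> 'a chart \<Rightarrow> real^3 \<Rightarrow> real^3" where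
  "transition c d x = snd d (inv_into (fst c) (snd c) x)"

definition compatible :: "'a chart \<Rightarrow> 'a chart \<Rightarrow> bool" where
  "compatible c d \<longleftrightarrow>
     (\<forall>i. smooth_on (\<lambda>x. transition c d x $ i) (overlap c d)) \<and>
     (\<forall>i. smooth_on (\<lambda>x. transition d c x $ i) (overlap d c))"

text \<open>The smooth structure \<open>A\<close> is a maximal atlas, so a diffeomorphism from an open set \<open>U\<close> onto an
  open subset of Euclidean space is the same thing as a member of \<open>A\<close> with domain \<open>U\<close>.\<close>

definition smooth_manifold :: "'a topology \<Rightarrow> 'a chart set \<Rightarrow> bool" where
  "smooth_manifold M A \<longleftrightarrow>
     Hausdorff_space M \<and> second_countable M \<and>
     (\<forall>c\<in>A. is_chart M c) \<and>
     (\<Union>c\<in>A. fst c) = topspace M \<and>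
     (\<forall>c\<in>A. \<forall>d\<in>A. compatible c d) \<and>
     (\<forall>c. is_chart M c \<and> (\<forall>d\<in>A. compatible c d) \<longrightarrow> c \<in> A)"

text \<open>A (0,2)-tensor field is given by its matrix of components \<open>T c x\<close> in each chart \<open>c\<close>, as a
  function of the coordinates \<open>x\<close>, subject to the transformation law.\<close>

type_synonym 'a tensor2 = "'a chart \<Rightarrow> real^3 \<Rightarrow> real^3^3"

definition jacobian :: "(real^3 \<Rightarrow> real^3) \<Rightarrow> real^3 \<Rightarrow> real^3^3" where
  "jacobian f x = matrix (frechet_derivative f (at x))"

definition symmetric_tensor :: "'a chart set \<Rightarrow> 'a tensor2 \<Rightarrow> bool" where
  "symmetric_tensor A T \<longleftrightarrow>
     (\<forall>c\<in>A. \<forall>i j. smooth_on (\<lambda>x. T c x $ i $ j) (snd c ` fst c)) \<and>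
     (\<forall>c\<in>A. \<forall>x\<in>snd c ` fst c. transpose (T c x) = T c x) \<and>
     (\<forall>c\<in>A. \<forall>d\<in>A. \<forall>x\<in>overlap c d.
        T c x = transpose (jacobian (transition c d) x) ** T d (transition c d x)
                  ** jacobian (transition c d) x)"

definition riemannian_metric :: "'a chart set \<Rightarrow> 'a tensor2 \<Rightarrow> bool" where
  "riemannian_metric A g \<longleftrightarrow> symmetric_tensor A g \<and>
     (\<forall>c\<in>A. \<forall>x\<in>snd c ` fst c. \<forall>v. v \<noteq> 0 \<longrightarrow> 0 < v \<bullet> (g c x *v v))"

definition initial_data_set :: "'a topology \<Rightarrow> 'a chart set \<Rightarrow> 'a tensor2 \<Rightarrow> 'a tensor2 \<Rightarrow> bool" where
  "initial_data_set M A g k \<longleftrightarrow>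
     smooth_manifold M A \<and> riemannian_metric A g \<and> symmetric_tensor A k"

text \<open>From here to \<open>current_density\<close>, \<open>g\<close>, \<open>h\<close> and \<open>k\<close> are component matrices as functions of the coordinates.\<close>

type_synonym tensor_comps = "real^3 \<Rightarrow> real^3^3"

definition metric_inv :: "tensor_comps \<Rightarrow> tensor_comps" where
  "metric_inv g x = matrix_inv (g x)"

definition metric_trace :: "tensor_comps \<Rightarrow> tensor_comps \<Rightarrow> real^3 \<Rightarrow> real" where
  "metric_trace g h x = (\<Sum>i\<in>UNIV. \<Sum>j\<in>UNIV. metric_inv g x $ i $ j * h x $ i $ j)"

definition tensor_norm_sq :: "tensor_comps \<Rightarrow> tensor_comps \<Rightarrow> real^3 \<Rightarrow> real" where
  "tensor_norm_sq g h x =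
     (\<Sum>i\<in>UNIV. \<Sum>j\<in>UNIV. \<Sum>a\<in>UNIV. \<Sum>b\<in>UNIV.
        metric_inv g x $ i $ a * metric_inv g x $ j $ b * h x $ i $ j * h x $ a $ b)"

definition covector_norm :: "tensor_comps \<Rightarrow> (real^3 \<Rightarrow> real^3) \<Rightarrow> real^3 \<Rightarrow> real" where
  "covector_norm g w x = sqrt (\<Sum>i\<in>UNIV. \<Sum>j\<in>UNIV. metric_inv g x $ i $ j * w x $ i * w x $ j)"

text \<open>\<open>christoffel g a b c\<close> has upper index \<open>a\<close> and lower indices \<open>b\<close>, \<open>c\<close>.\<close>

definition christoffel :: "tensor_comps \<Rightarrow> 3 \<Rightarrow> 3 \<Rightarrow> 3 \<Rightarrow> real^3 \<Rightarrow> real" where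
  "christoffel g a b c x = 1/2 * (\<Sum>d\<in>UNIV. metric_inv g x $ a $ d *
     (partial b (\<lambda>y. g y $ d $ c) x + partial c (\<lambda>y. g y $ d $ b) x
        - partial d (\<lambda>y. g y $ b $ c) x))"

text \<open>Sign convention: the scalar curvature of round spheres is positive.\<close>

definition ricci :: "tensor_comps \<Rightarrow> 3 \<Rightarrow> 3 \<Rightarrow> real^3 \<Rightarrow> real" where
  "ricci g b c x = (\<Sum>a\<in>UNIV.
     partial a (christoffel g a b c) x - partial c (christoffel g a b a) x
     + (\<Sum>d\<in>UNIV. christoffel g a a d x * christoffel g d b c x
                - christoffel g a c d x * christoffel g d b a x))"

definition scalar_curvature :: "tensor_comps \<Rightarrow> real^3 \<Rightarrow> real" where
  "scalar_curvature g x = (\<Sum>b\<in>UNIV. \<Sum>c\<in>UNIV. metric_inv g x $ b $ c * ricci g b c x)"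

definition covariant_deriv :: "tensor_comps \<Rightarrow> tensor_comps \<Rightarrow> 3 \<Rightarrow> 3 \<Rightarrow> 3 \<Rightarrow> real^3 \<Rightarrow> real" where
  "covariant_deriv g h a i j x = partial a (\<lambda>y. h y $ i $ j) x
     - (\<Sum>d\<in>UNIV. christoffel g d a i x * h x $ d $ j + christoffel g d a j x * h x $ i $ d)"

definition divergence :: "tensor_comps \<Rightarrow> tensor_comps \<Rightarrow> real^3 \<Rightarrow> real^3" where
  "divergence g h x = (\<chi> j. \<Sum>a\<in>UNIV. \<Sum>i\<in>UNIV. metric_inv g x $ a $ i * covariant_deriv g h a i j x)"

definition conj_momentum :: "tensor_comps \<Rightarrow> tensor_comps \<Rightarrow> tensor_comps" where
  "conj_momentum g k x = k x - metric_trace g k x *\<^sub>R g x"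

definition mass_density :: "tensor_comps \<Rightarrow> tensor_comps \<Rightarrow> real^3 \<Rightarrow> real" where
  "mass_density g k x = 1/2 * (scalar_curvature g x - tensor_norm_sq g (conj_momentum g k) x
     + 1/2 * (metric_trace g (conj_momentum g k) x)^2)"

definition current_density :: "tensor_comps \<Rightarrow> tensor_comps \<Rightarrow> real^3 \<Rightarrow> real^3" where
  "current_density g k = divergence g (conj_momentum g k)"

primrec partials :: "3 list \<Rightarrow> (real^3 \<Rightarrow> real) \<Rightarrow> real^3 \<Rightarrow> real" where
  "partials [] f = f"
| "partials (i # is) f = partial i (partials is f)"

definition bigO_deriv :: "nat \<Rightarrow> real \<Rightarrow> (real^3 \<Rightarrow> real) \<Rightarrow> bool" where
  "bigO_deriv l a f \<longleftrightarrow> (\<exists>R. Ck_on l f {x. R < norm x}) \<and>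
     (\<forall>is. length is \<le> l \<longrightarrow> partials is f \<in> O[at_infinity](\<lambda>x. norm x powr (a - length is)))"

definition smallo_deriv :: "nat \<Rightarrow> real \<Rightarrow> (real^3 \<Rightarrow> real) \<Rightarrow> bool" where
  "smallo_deriv l a f \<longleftrightarrow> (\<exists>R. Ck_on l f {x. R < norm x}) \<and>
     (\<forall>is. length is \<le> l \<longrightarrow> partials is f \<in> o[at_infinity](\<lambda>x. norm x powr (a - length is)))"

definition asymptotically_flat_coords ::
    "real \<Rightarrow> real \<Rightarrow> real \<Rightarrow> tensor_comps \<Rightarrow> tensor_comps \<Rightarrow> bool" where
  "asymptotically_flat_coords q p \<epsilon> g k \<longleftrightarrow>
     (\<forall>i j. bigO_deriv 2 (-q) (\<lambda>x. g x $ i $ j - (if i = j then 1 else 0))) \<and>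
     (\<forall>i j. bigO_deriv 1 (-p) (\<lambda>x. k x $ i $ j)) \<and>
     mass_density g k \<in> O[at_infinity](\<lambda>x. norm x powr (-3 - \<epsilon>)) \<and>
     covector_norm g (current_density g k) \<in> O[at_infinity](\<lambda>x. norm x powr (-3 - \<epsilon>))"

definition ends :: "'a topology \<Rightarrow> 'a set \<Rightarrow> 'a set set" where
  "ends M K = connected_components_of (subtopology M (topspace M - K))"

text \<open>The compact set \<open>K\<close> and, for every end \<open>E\<close>, the asymptotically flat coordinates
  \<open>\<Phi> E\<close> on \<open>E\<close> are part of the data, since later hypotheses refer to these coordinates.\<close>

definition asymptotically_flat ::
    "real \<Rightarrow> real \<Rightarrow> real \<Rightarrow> 'a topology \<Rightarrow> 'a chart set \<Rightarrow> 'a tensor2 \<Rightarrow> 'a tensor2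
      \<Rightarrow> 'a set \<Rightarrow> ('a set \<Rightarrow> 'a \<Rightarrow> real^3) \<Rightarrow> bool" where
  "asymptotically_flat q p \<epsilon> M A g k K \<Phi> \<longleftrightarrow>
     compactin M K \<and> finite (ends M K) \<and>
     (\<forall>E\<in>ends M K. (E, \<Phi> E) \<in> A \<and> (\<exists>C. compact C \<and> \<Phi> E ` E = - C) \<and>
        asymptotically_flat_coords q p \<epsilon> (g (E, \<Phi> E)) (k (E, \<Phi> E)))"

text \<open>Area measure of the round sphere of radius \<open>r\<close>: the push-forward of the area element
  \<open>r\<^sup>2 sin \<theta> d\<theta> d\<phi>\<close> under spherical coordinates. It lives on the sphere only, so that integrals do
  not depend on values of the integrand off the sphere.\<close>

definition spherical :: "real \<Rightarrow> real \<times> real \<Rightarrow> real^3" where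
  "spherical r = (\<lambda>(\<theta>, \<phi>). vector [r * sin \<theta> * cos \<phi>, r * sin \<theta> * sin \<phi>, r * cos \<theta>])"

definition sphere_measure :: "real \<Rightarrow> (real^3) measure" where
  "sphere_measure r =
     distr (density (restrict_space lborel (cbox (0, 0) (pi, 2 * pi))) (\<lambda>(\<theta>, \<phi>). ennreal (r^2 * sin \<theta>)))
       (restrict_space borel (sphere 0 r)) (spherical r)"

definition rotation_field :: "3 \<Rightarrow> real^3 \<Rightarrow> real^3" where
  "rotation_field i x = cross3 (axis i 1) x"

definition angular_momentum_at :: "tensor_comps \<Rightarrow> (real^3 \<Rightarrow> real^3) \<Rightarrow> real \<Rightarrow> real" where
  "angular_momentum_at h Y r = 1 / (8 * pi) *
     (\<integral>x. (\<Sum>j\<in>UNIV. \<Sum>k\<in>UNIV. h x $ j $ k * Y x $ j * (x $ k / norm x)) \<partial>sphere_measure r)"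

text \<open>Here \<open>b\<close> and \<open>c\<close> are only used on the unit sphere.\<close>

definition momentum_expansion ::
    "real \<Rightarrow> tensor_comps \<Rightarrow> tensor_comps \<Rightarrow> tensor_comps \<Rightarrow> bool" where
  "momentum_expansion p h b c \<longleftrightarrow>
     (\<forall>w\<in>sphere 0 1. transpose (b w) = b w \<and> transpose (c w) = c w) \<and>
     (\<forall>i j. smallo_deriv 1 (-3) (\<lambda>x. h x $ i $ j
        - (b (x /\<^sub>R norm x) $ i $ j * norm x powr (-p) + c (x /\<^sub>R norm x) $ i $ j * norm x powr (-3))))"

end

(*
  Write h for the momentum tensor and I(r) for its flux through the sphere of radius r, contracted
  with the rotation field Y. The expansion gives I(r) = A r^(3-p) + B + o(1). Since g tends to the
  Euclidean metric with first derivatives o(1/r), the decay of J forces the Euclidean divergence of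
  h to be o(r^(-p-1)), and as Y is a Killing field, the divergence theorem yields
  I'(r) = o(r^(2-p)). By the mean value theorem on [r, 2r] this is incompatible with A \<noteq> 0,
  so I(r) tends to B.
*)

theory Submission
  imports Defs
begin

section \<open>Partial derivatives and decay classes\<close>

text \<open>The bound on the derivative of the flux does not yield convergence by itself: r^(2-p) is
  not integrable at infinity when p < 3. The expansion already gives convergence up to the term A
  r^(3-p), and the derivative serves to exclude that single term. The obstacle is that no regularity
  is stated for the angular tensors of the expansion. The flux is therefore differentiated through
  h, which is C^1 near infinity because the metric and k are, and the angular tensors only have to
  become integrable over the sphere. The rate r^(-p-1) is chosen as the threshold for the divergence
  because it is the size of the first derivatives of h: with any positive q each metric correction
  falls strictly below it, and J does so because p < 3. The factor Y contributes one power of r and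
  the area of the sphere two more, which leads to r^(2-p).\<close>

lemma partial_eqI:
  assumes "(f has_derivative D) (at x)"
  shows "partial i f x = D (axis i 1)"
  using frechet_derivative_at[OF assms] by (simp add: partial_def)

text \<open>With the derivative written out in partials, the rules for sums, products and
  reciprocals follow by evaluating a Frechet derivative on a basis vector.\<close>

lemma has_derivative_partial:
  assumes "f differentiable (at x)"
  shows "(f has_derivative (\<lambda>v. \<Sum>i\<in>UNIV. partial i f x * v $ i)) (at x)"
proof -
  define D where "D = frechet_derivative f (at x)"
  have D: "(f has_derivative D) (at x)"
    using assms unfolding D_def frechet_derivative_works .
  then have lin: "linear D" by (rule has_derivative_linear)
  have "D = (\<lambda>v. \<Sum>i\<in>UNIV. partial i f x * v $ i)"
  proof
    fix v :: "real^3"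
    have "D v = D (\<Sum>i\<in>UNIV. (v $ i) *\<^sub>R axis i 1)"
      by (metis (no_types) basis_expansion scalar_mult_eq_scaleR)
    also have "\<dots> = (\<Sum>i\<in>UNIV. v $ i * D (axis i 1))"
      by (simp add: linear_sum[OF lin] linear_cmul[OF lin])
    finally show "D v = (\<Sum>i\<in>UNIV. partial i f x * v $ i)"
      by (simp add: partial_def D_def mult.commute)
  qed
  with D show ?thesis by simp
qed

lemma partial_add:
  assumes "f differentiable (at x)" "g differentiable (at x)"
  shows "partial i (\<lambda>x. f x + g x) x = partial i f x + partial i g x"
  by (subst partial_eqI[OF has_derivative_add[OF assms[THEN has_derivative_partial]]])
     (simp add: axis_def if_distrib sum.delta' cong: if_cong)

lemma partial_mult:
  assumes "f differentiable (at x)" "g differentiable (at x)"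
  shows "partial i (\<lambda>x. f x * g x) x = f x * partial i g x + partial i f x * g x"
  by (subst partial_eqI[OF has_derivative_mult[OF assms[THEN has_derivative_partial]]])
     (simp add: axis_def if_distrib sum.delta' cong: if_cong)

lemma partial_inverse:
  assumes "f differentiable (at x)" "f x \<noteq> 0"
  shows "partial i (\<lambda>x. inverse (f x)) x = - (inverse (f x) * partial i f x * inverse (f x))"
  by (subst partial_eqI[OF Deriv.has_derivative_inverse[OF assms(2) has_derivative_partial[OF assms(1)]]])
     (simp add: axis_def if_distrib sum.delta' cong: if_cong)

lemma partial_const [simp]: "partial i (\<lambda>x. c) x = 0"
  by (subst partial_eqI[OF has_derivative_const]) simp

text \<open>An equality of functions, valid even where \<open>f\<close> is not differentiable:
  \<open>frechet_derivative\<close> is a choice among the derivatives, and both functions have the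
  same ones.\<close>

lemma partial_diff_const: "partial i (\<lambda>x. f x - c) = partial i f"
proof -
  have "((\<lambda>x. f x - c) has_derivative D) (at x) \<longleftrightarrow> (f has_derivative D) (at x)" for D x
    using has_derivative_add[OF _ has_derivative_const[of c], of "\<lambda>x. f x - c" D "at x"]
          has_derivative_diff[OF _ has_derivative_const[of c], of f D "at x"] by auto
  then show ?thesis by (simp add: partial_def frechet_derivative_def fun_eq_iff)
qed

lemma partial_cong_open:
  assumes "open S" "x \<in> S" "\<And>y. y \<in> S \<Longrightarrow> f y = g y"
  shows "partial i f x = partial i g x"
proof -
  have "(f has_derivative D) (at x) \<longleftrightarrow> (g has_derivative D) (at x)" for D
    using has_derivative_transform_within_open[of f D x UNIV S g]
      has_derivative_transform_within_open[of g D x UNIV S f] assms by auto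
  then show ?thesis by (simp add: partial_def frechet_derivative_def)
qed

section \<open>Powers of the norm and the calculus of C^1 decay classes at infinity\<close>

lemma open_norm_greater: "open {x::real^3. R < norm x}"
  by (intro open_Collect_less continuous_intros)

lemma eventually_norm_greater: "eventually (\<lambda>x::real^3. R < norm x) at_infinity"
  by (auto simp: eventually_at_infinity intro!: exI[of _ "R + 1"])

lemma filterlim_norm_at_infinity: "filterlim (norm :: real^3 \<Rightarrow> real) at_top at_infinity"
  by (rule filterlim_at_infinity_imp_norm_at_top[OF filterlim_ident])

lemma norm_powr_bigo_iff:
  "(\<lambda>x::real^3. norm x powr a) \<in> O[at_infinity](\<lambda>x. norm x powr b) \<longleftrightarrow> a \<le> b"
  by (rule powr_bigo_iff[OF filterlim_norm_at_infinity trivial_limit_at_infinity])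

lemma norm_powr_smallo_iff:
  "(\<lambda>x::real^3. norm x powr a) \<in> o[at_infinity](\<lambda>x. norm x powr b) \<longleftrightarrow> a < b"
  by (rule powr_smallo_iff[OF filterlim_norm_at_infinity trivial_limit_at_infinity])

lemma length_le_1_cases: "length is \<le> Suc 0 \<longleftrightarrow> is = [] \<or> (\<exists>i. is = [i])"
  by (cases "is") auto

lemma bigO_deriv_1_iff:
  "bigO_deriv 1 a f \<longleftrightarrow>
     (\<exists>R. (\<forall>x. R < norm x \<longrightarrow> f differentiable (at x)) \<and>
          (\<forall>i. continuous_on {x. R < norm x} (partial i f))) \<and>
     f \<in> O[at_infinity](\<lambda>x. norm x powr a) \<and>
     (\<forall>i. partial i f \<in> O[at_infinity](\<lambda>x. norm x powr (a - 1)))"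
  by (auto simp: bigO_deriv_def length_le_1_cases)

lemma bigO_derivD:
  assumes "bigO_deriv 1 a f"
  shows "f \<in> O[at_infinity](\<lambda>x. norm x powr a)"
    and "partial i f \<in> O[at_infinity](\<lambda>x. norm x powr (a - 1))"
    and "\<exists>R. (\<forall>x. R < norm x \<longrightarrow> f differentiable (at x)) \<and>
          (\<forall>i. continuous_on {x. R < norm x} (partial i f))"
  using assms unfolding bigO_deriv_1_iff by auto

lemma differentiable_imp_continuous_outside:
  assumes "\<forall>x. R < norm x \<longrightarrow> (f :: real^3 \<Rightarrow> real) differentiable (at x)"
  shows "continuous_on {x. R < norm x} f"
  using assms by (intro continuous_at_imp_continuous_on) (auto intro: differentiable_imp_continuous_within)

lemma bigO_deriv_two_regions:
  assumes "bigO_deriv 1 a f" "bigO_deriv 1 b g"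
  obtains R where "\<And>x. R < norm x \<Longrightarrow> f differentiable (at x)"
    "\<And>i. continuous_on {x. R < norm x} (partial i f)" "continuous_on {x. R < norm x} f"
    "\<And>x. R < norm x \<Longrightarrow> g differentiable (at x)"
    "\<And>i. continuous_on {x. R < norm x} (partial i g)" "continuous_on {x. R < norm x} g"
proof -
  obtain R1 where 1: "\<forall>x. R1 < norm x \<longrightarrow> f differentiable (at x)"
      "\<forall>i. continuous_on {x. R1 < norm x} (partial i f)"
    using bigO_derivD(3)[OF assms(1)] by auto
  obtain R2 where 2: "\<forall>x. R2 < norm x \<longrightarrow> g differentiable (at x)"
      "\<forall>i. continuous_on {x. R2 < norm x} (partial i g)"
    using bigO_derivD(3)[OF assms(2)] by auto
  have "{x::real^3. max R1 R2 < norm x} \<subseteq> {x. R1 < norm x}"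
    "{x::real^3. max R1 R2 < norm x} \<subseteq> {x. R2 < norm x}" by auto
  note sub = this[THEN continuous_on_subset[rotated]]
  show thesis
    by (rule that[of "max R1 R2"]; (rule sub)?)
       (use 1 2 in \<open>auto dest: differentiable_imp_continuous_outside\<close>)
qed

lemma bigO_deriv_mono:
  assumes "bigO_deriv 1 a f" "a \<le> b"
  shows "bigO_deriv 1 b f"
  unfolding bigO_deriv_1_iff
  using bigO_derivD(3)[OF assms(1)] assms(2)
    landau_o.big_trans[OF bigO_derivD(1)[OF assms(1)], of "\<lambda>x. norm x powr b"]
    landau_o.big_trans[OF bigO_derivD(2)[OF assms(1)], of "\<lambda>x. norm x powr (b - 1)"]
  by (auto simp: norm_powr_bigo_iff)

lemma bigO_deriv_const: "bigO_deriv 1 0 (\<lambda>x. c)"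
  unfolding bigO_deriv_1_iff
  \<comment> \<open>\<open>0 powr 0\<close> is 0, so comparison of a constant with
    \<open>norm x powr 0\<close> is made off the origin only.\<close>
  by (auto intro!: exI[of _ 0] bigoI[of _ "\<bar>c\<bar>"] eventually_mono[OF eventually_norm_greater[of 0]])

lemma bigO_deriv_cong:
  assumes f: "bigO_deriv 1 a f" and eq: "\<And>x. R < norm x \<Longrightarrow> f x = g x"
  shows "bigO_deriv 1 a g"
proof -
  obtain R1 where 1: "\<forall>x. R1 < norm x \<longrightarrow> f differentiable (at x)"
      "\<forall>i. continuous_on {x. R1 < norm x} (partial i f)"
    using bigO_derivD(3)[OF f] by auto
  have p: "partial i f x = partial i g x" if "R < norm x" for i x
    by (rule partial_cong_open[OF open_norm_greater[of R]]) (use that eq in auto)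
  have d: "g differentiable (at x)" if "max R R1 < norm x" for x
  proof -
    have "(f has_derivative frechet_derivative f (at x)) (at x)"
      using 1 that frechet_derivative_works[of f "at x"] by simp
    then have "(g has_derivative frechet_derivative f (at x)) (at x)"
      by (rule has_derivative_transform_within_open[OF _ open_norm_greater[of R]])
         (use that eq in auto)
    then show ?thesis by (auto simp: differentiable_def)
  qed
  have c: "continuous_on {x. max R R1 < norm x} (partial i g)" for i
  proof -
    have "continuous_on {x. max R R1 < norm x} (partial i f)"
      by (rule continuous_on_subset[of "{x. R1 < norm x}"]) (use 1 in auto)
    then show ?thesis by (rule continuous_on_eq) (use p in auto)
  qed
  have "eventually (\<lambda>x. f x = g x) at_infinity" "eventually (\<lambda>x. partial i f x = partial i g x) at_infinity" for i
    by (rule eventually_mono[OF eventually_norm_greater[of R]]; simp add: eq p)+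
  then have "g \<in> O[at_infinity](\<lambda>x. norm x powr a)"
     "partial i g \<in> O[at_infinity](\<lambda>x. norm x powr (a - 1))" for i
    using bigO_derivD(1,2)[OF f] landau_o.big.in_cong by fast+
  then show ?thesis unfolding bigO_deriv_1_iff using c d by blast
qed

lemma bigo_eventually_cong:
  assumes "f \<in> O[F](h)" "eventually (\<lambda>x. f x = g x) F"
  shows "g \<in> O[F](h)"
  using assms landau_o.big.in_cong by fast

lemma bigO_deriv_add:
  assumes "bigO_deriv 1 a f" "bigO_deriv 1 a g"
  shows "bigO_deriv 1 a (\<lambda>x. f x + g x)"
proof -
  obtain R where R: "\<And>x. R < norm x \<Longrightarrow> f differentiable (at x)"
    "\<And>i. continuous_on {x. R < norm x} (partial i f)" "continuous_on {x. R < norm x} f"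
    "\<And>x. R < norm x \<Longrightarrow> g differentiable (at x)"
    "\<And>i. continuous_on {x. R < norm x} (partial i g)" "continuous_on {x. R < norm x} g"
    using bigO_deriv_two_regions[OF assms] by metis
  have p: "partial i (\<lambda>x. f x + g x) x = partial i f x + partial i g x" if "R < norm x" for i x
    using R that by (intro partial_add) auto
  have "continuous_on {x. R < norm x} (partial i (\<lambda>x. f x + g x))" for i
    by (rule continuous_on_eq[OF continuous_on_add[OF R(2,5)]]) (simp add: p)
  moreover have "partial i (\<lambda>x. f x + g x) \<in> O[at_infinity](\<lambda>x. norm x powr (a - 1))" for i
    by (rule bigo_eventually_cong[OF sum_in_bigo(1)[OF bigO_derivD(2)[OF assms(1)] bigO_derivD(2)[OF assms(2)]]])
       (rule eventually_mono[OF eventually_norm_greater[of R]], simp add: p)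
  ultimately show ?thesis
    unfolding bigO_deriv_1_iff using R sum_in_bigo(1)[OF bigO_derivD(1)[OF assms(1)] bigO_derivD(1)[OF assms(2)]]
    by (blast intro: differentiable_add)
qed

lemma bigO_deriv_mult:
  assumes "bigO_deriv 1 a f" "bigO_deriv 1 b g"
  shows "bigO_deriv 1 (a + b) (\<lambda>x. f x * g x)"
proof -
  obtain R where R: "\<And>x. R < norm x \<Longrightarrow> f differentiable (at x)"
    "\<And>i. continuous_on {x. R < norm x} (partial i f)" "continuous_on {x. R < norm x} f"
    "\<And>x. R < norm x \<Longrightarrow> g differentiable (at x)"
    "\<And>i. continuous_on {x. R < norm x} (partial i g)" "continuous_on {x. R < norm x} g"
    using bigO_deriv_two_regions[OF assms] by metis
  have p: "partial i (\<lambda>x. f x * g x) x = f x * partial i g x + partial i f x * g x" if "R < norm x" for i x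
    using R that by (intro partial_mult) auto
  have "continuous_on {x. R < norm x} (partial i (\<lambda>x. f x * g x))" for i
    by (rule continuous_on_eq[OF continuous_on_add[OF continuous_on_mult[OF R(3,5)] continuous_on_mult[OF R(2,6)]]])
       (simp add: p)
  moreover have "f \<in> O[at_infinity](\<lambda>x. norm x powr a)" "g \<in> O[at_infinity](\<lambda>x. norm x powr b)"
     "partial i f \<in> O[at_infinity](\<lambda>x. norm x powr (a - 1))"
     "partial i g \<in> O[at_infinity](\<lambda>x. norm x powr (b - 1))" for i
    using assms bigO_derivD by blast+
  note O = this
  have "(\<lambda>x. f x * partial i g x + partial i f x * g x) \<in> O[at_infinity](\<lambda>x. norm x powr (a + b - 1))" for i
    using landau_o.big.mult[OF O(1) O(4)] landau_o.big.mult[OF O(3) O(2)]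
    by (intro sum_in_bigo) (simp_all add: powr_add[symmetric] algebra_simps)
  then have "partial i (\<lambda>x. f x * g x) \<in> O[at_infinity](\<lambda>x. norm x powr (a + b - 1))" for i
    by (rule bigo_eventually_cong)
       (rule eventually_mono[OF eventually_norm_greater[of R]], simp add: p)
  moreover have "(\<lambda>x. f x * g x) \<in> O[at_infinity](\<lambda>x. norm x powr (a + b))"
    using landau_o.big.mult[OF O(1) O(2)] by (simp add: powr_add[symmetric])
  ultimately show ?thesis
    unfolding bigO_deriv_1_iff using R
    by (blast intro: differentiable_mult)
qed

lemma bigO_deriv_minus:
  assumes "bigO_deriv 1 a f"
  shows "bigO_deriv 1 a (\<lambda>x. - f x)"
  using bigO_deriv_mult[OF bigO_deriv_const[of "-1"] assms] by simp

lemma bigO_deriv_diff: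
  assumes "bigO_deriv 1 a f" "bigO_deriv 1 a g"
  shows "bigO_deriv 1 a (\<lambda>x. f x - g x)"
  using bigO_deriv_add[OF assms(1) bigO_deriv_minus[OF assms(2)]] by simp

text \<open>A nonzero limit keeps the reciprocal bounded near infinity. Its partials are those of
  \<open>f\<close> times the squared reciprocal, up to sign, so they decay at the same rate.\<close>

lemma bigO_deriv_inverse:
  assumes f: "bigO_deriv 1 0 f" and lim: "(f \<longlongrightarrow> L) at_infinity" and L: "L \<noteq> 0"
  shows "bigO_deriv 1 0 (\<lambda>x. inverse (f x))"
proof -
  obtain R0 where R0: "\<And>x. R0 < norm x \<Longrightarrow> f differentiable (at x)"
    "\<And>i. continuous_on {x. R0 < norm x} (partial i f)"
    using bigO_derivD(3)[OF f] by blast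
  obtain R1 where R1: "\<And>x. R1 \<le> norm x \<Longrightarrow> f x \<noteq> 0"
    using tendsto_imp_eventually_ne[OF lim L] unfolding eventually_at_infinity by auto
  define R where "R = max R0 R1"
  have R: "f differentiable (at x)" "f x \<noteq> 0" if "R < norm x" for x
    using R0 R1 that by (auto simp: R_def)
  have cp: "continuous_on {x. R < norm x} (partial i f)" for i
    by (rule continuous_on_subset[OF R0(2)]) (auto simp: R_def)
  have cf: "continuous_on {x. R < norm x} (\<lambda>x. inverse (f x))"
    by (rule continuous_on_inverse[OF differentiable_imp_continuous_outside]) (use R in auto)
  have p: "partial i (\<lambda>x. inverse (f x)) x = - (inverse (f x) * partial i f x * inverse (f x))"
    if "R < norm x" for i x
    using R that by (intro partial_inverse) auto
  have c: "continuous_on {x. R < norm x} (partial i (\<lambda>x. inverse (f x)))" for i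
    by (rule continuous_on_eq[of _ "\<lambda>x. - (inverse (f x) * partial i f x * inverse (f x))"])
       (simp_all add: p continuous_on_minus continuous_on_mult cp cf)
  have "(\<lambda>x. inverse (f x)) \<in> O[at_infinity](\<lambda>x. 1)"
    by (rule bigoI_tendsto[of _ _ "inverse L"]) (use tendsto_inverse[OF lim L] in auto)
  also have "(\<lambda>x::real^3. 1::real) \<in> O[at_infinity](\<lambda>x. norm x powr 0)"
    by (rule bigoI[of _ 1]) (rule eventually_mono[OF eventually_norm_greater[of 0]], simp)
  finally have O: "(\<lambda>x. inverse (f x)) \<in> O[at_infinity](\<lambda>x. norm x powr 0)" .
  have O2: "(\<lambda>x. - (inverse (f x) * partial i f x * inverse (f x))) \<in> O[at_infinity](\<lambda>x. norm x powr (0 - 1))" for i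
    using landau_o.big.mult[OF landau_o.big.mult[OF O bigO_derivD(2)[OF f, of i]] O]
    by (simp only: powr_add[symmetric] landau_o.big.uminus_in_iff) simp
  have "partial i (\<lambda>x. inverse (f x)) \<in> O[at_infinity](\<lambda>x. norm x powr (0 - 1))" for i
    by (rule bigo_eventually_cong[OF O2[of i]])
       (rule eventually_mono[OF eventually_norm_greater[of R]], simp add: p)
  moreover have "(\<lambda>x. inverse (f x)) differentiable (at x)" if "R < norm x" for x
    using R[OF that] by (rule differentiable_inverse)
  ultimately show ?thesis unfolding bigO_deriv_1_iff using O c by blast
qed

section \<open>Asymptotically Euclidean metrics\<close>

text \<open>The continuity of first partials demanded by \<open>Ck_on 1\<close> comes from their
  differentiability, which is the form in which \<open>Ck_on 2\<close> provides it.\<close>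

lemma bigO_deriv_2_imp_1:
  assumes "bigO_deriv 2 a f"
  shows "bigO_deriv 1 a f"
proof -
  obtain R where "Ck_on 2 f {x. R < norm x}"
    using assms unfolding bigO_deriv_def by blast
  then have "Ck_on 1 f {x. R < norm x}"
    unfolding One_nat_def numeral_2_eq_2
    by (auto intro!: continuous_at_imp_continuous_on differentiable_imp_continuous_within)
  moreover have "\<forall>is. length is \<le> 1 \<longrightarrow> partials is f \<in> O[at_infinity](\<lambda>x. norm x powr (a - length is))"
    using assms unfolding bigO_deriv_def by auto
  ultimately show ?thesis unfolding bigO_deriv_def by blast
qed

lemma matrix_mul_matrix_inv:
  fixes A :: "'a::field^'n^'n"
  assumes "det A \<noteq> 0"
  shows "A ** matrix_inv A = mat 1"
proof -
  have "\<exists>B. A ** B = mat 1 \<and> B ** A = mat 1"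
    using assms by (simp add: invertible_det_nz[symmetric] invertible_def)
  then have "A ** matrix_inv A = mat 1 \<and> matrix_inv A ** A = mat 1"
    unfolding matrix_inv_def by (rule someI_ex)
  then show ?thesis ..
qed

text \<open>Cramer's rule for the columns of the inverse. It turns every entry into a polynomial in
  the entries of \<open>A\<close> divided by the determinant, a form to which the product and
  reciprocal rules for \<open>bigO_deriv\<close> apply.\<close>

lemma matrix_inv_cofactor:
  fixes A :: "real^'n^'n"
  assumes "det A \<noteq> 0"
  shows "matrix_inv A $ i $ j =
    inverse (det A) * det (\<chi> a b. if b = i then (if a = j then 1 else 0) else A $ a $ b)"
proof -
  have "A ** matrix_inv A = mat 1"
    using assms by (rule matrix_mul_matrix_inv)
  then have "A *v column j (matrix_inv A) = axis j 1"
    by (simp add: matrix_vector_mult_def matrix_matrix_mult_def column_def mat_def vec_eq_iff axis_def)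
  then have "column j (matrix_inv A) = (\<chi> i. det (\<chi> a b. if b = i then axis j 1 $ a else A $ a $ b) / det A)"
    by (simp add: cramer[OF assms])
  then have "matrix_inv A $ i $ j = det (\<chi> a b. if b = i then axis j 1 $ a else A $ a $ b) / det A"
    by (simp add: column_def vec_eq_iff)
  then show ?thesis
    by (simp add: axis_def divide_inverse mult.commute cong: if_cong)
qed

lemma bigO_deriv_mult0: "bigO_deriv 1 0 f \<Longrightarrow> bigO_deriv 1 a g \<Longrightarrow> bigO_deriv 1 a (\<lambda>x. f x * g x)"
  using bigO_deriv_mult[of 0 f a g] by simp

lemma bigO_deriv_det:
  assumes "\<And>i j. bigO_deriv 1 0 (\<lambda>x. G x $ i $ j)"
  shows "bigO_deriv 1 0 (\<lambda>x. det (G x :: real^3^3))"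
proof -
  have "bigO_deriv 1 0 (\<lambda>x. G x $ a $ b * G x $ c $ d * G x $ e $ f)" for a b c d e f
    by (rule bigO_deriv_mult0[OF bigO_deriv_mult0[OF assms assms] assms])
  note prod = this
  show ?thesis
    unfolding det_3 by (rule bigO_deriv_add bigO_deriv_diff prod)+
qed

lemma tendsto_det_3:
  assumes "\<And>i j. ((\<lambda>x. G x $ i $ j) \<longlongrightarrow> L $ i $ j) F"
  shows "((\<lambda>x. det (G x :: real^3^3)) \<longlongrightarrow> det L) F"
  unfolding det_3 by (rule tendsto_add tendsto_diff tendsto_mult assms)+

lemma bigO_deriv_sum:
  assumes "finite A" "A \<noteq> {}" "\<And>i. i \<in> A \<Longrightarrow> bigO_deriv 1 a (f i)"
  shows "bigO_deriv 1 a (\<lambda>x. \<Sum>i\<in>A. f i x)"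
  using assms by (induction A rule: finite_ne_induct) (auto intro: bigO_deriv_add simp del: One_nat_def)

lemma bigo_neg_powr_imp_tendsto_0:
  fixes f :: "real^3 \<Rightarrow> real"
  assumes "f \<in> O[at_infinity](\<lambda>x. norm x powr a)" "a < 0"
  shows "(f \<longlongrightarrow> 0) at_infinity"
proof -
  have "(\<lambda>x::real^3. norm x powr a) \<in> o[at_infinity](\<lambda>x. norm x powr 0)"
    using assms(2) by (simp only: norm_powr_smallo_iff)
  from landau_o.big_small_trans[OF assms(1) this]
  have "f \<in> o[at_infinity](\<lambda>x. norm x powr 0)" .
  from smalloD_tendsto[OF this] show ?thesis
    by (rule Lim_transform_eventually)
       (rule eventually_mono[OF eventually_norm_greater[of 0]], simp)
qed

section \<open>Metric, Christoffel symbols and divergence in one asymptotically flat chart\<close>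

context
  fixes g :: tensor_comps and q :: real
  assumes q: "0 < q"
    and g_flat: "\<And>i j. bigO_deriv 2 (-q) (\<lambda>x. g x $ i $ j - (if i = j then 1 else 0))"
begin

text \<open>The exact rate -q is given up for a limit and a little-o: an o(1/r) factor against an
  O(r^(-p)) tensor is exactly what falls below r^(-p-1).\<close>

lemma metric_asymp:
  "bigO_deriv 1 0 (\<lambda>x. g x $ i $ j)"
  "((\<lambda>x. g x $ i $ j) \<longlongrightarrow> mat 1 $ i $ j) at_infinity"
  "partial d (\<lambda>x. g x $ i $ j) \<in> o[at_infinity](\<lambda>x. norm x powr -1)"
proof -
  note 1 = bigO_deriv_2_imp_1[OF g_flat]
  show "bigO_deriv 1 0 (\<lambda>x. g x $ i $ j)"
    using bigO_deriv_add[OF bigO_deriv_mono[OF 1] bigO_deriv_const, of i j "if i = j then 1 else 0"] q by simp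
  have "((\<lambda>x. g x $ i $ j - (if i = j then 1 else 0)) \<longlongrightarrow> 0) at_infinity"
    by (rule bigo_neg_powr_imp_tendsto_0[OF bigO_derivD(1)[OF 1]]) (use q in simp)
  from LIM_zero_cancel[OF this] show "((\<lambda>x. g x $ i $ j) \<longlongrightarrow> mat 1 $ i $ j) at_infinity"
    by (simp add: mat_def cong: if_cong)
  have "partial d (\<lambda>x. g x $ i $ j) \<in> O[at_infinity](\<lambda>x. norm x powr (-q - 1))"
    using bigO_derivD(2)[OF 1, of d i j] by (simp only: partial_diff_const)
  also have "(\<lambda>x::real^3. norm x powr (-q - 1)) \<in> o[at_infinity](\<lambda>x. norm x powr -1)"
    unfolding norm_powr_smallo_iff using q by simp
  finally show "partial d (\<lambda>x. g x $ i $ j) \<in> o[at_infinity](\<lambda>x. norm x powr -1)" .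
qed

lemma metric_inv_asymp:
  "bigO_deriv 1 0 (\<lambda>x. metric_inv g x $ i $ j)"
  "((\<lambda>x. metric_inv g x $ i $ j) \<longlongrightarrow> mat 1 $ i $ j) at_infinity"
proof -
  define C :: "real^3^3 \<Rightarrow> real^3^3"
    where "C A = (\<chi> a b. if b = i then (if a = j then 1 else 0) else A $ a $ b)" for A
  have limdet: "((\<lambda>x. det (g x)) \<longlongrightarrow> 1) at_infinity"
    using tendsto_det_3[OF metric_asymp(2)] by simp
  then have "eventually (\<lambda>x. det (g x) \<noteq> 0) at_infinity"
    by (rule tendsto_imp_eventually_ne) simp
  then obtain R where "\<And>x. R \<le> norm x \<Longrightarrow> det (g x) \<noteq> 0"
    unfolding eventually_at_infinity by auto
  then have eq: "inverse (det (g x)) * det (C (g x)) = metric_inv g x $ i $ j" if "R < norm x" for x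
    using that by (simp add: metric_inv_def matrix_inv_cofactor C_def)
  have "bigO_deriv 1 0 (\<lambda>x. C (g x) $ a $ b)" for a b
    using metric_asymp(1)[of a b] bigO_deriv_const[of "if a = j then 1 else 0"] by (cases "b = i") (simp_all add: C_def del: One_nat_def)
  then have "bigO_deriv 1 0 (\<lambda>x. inverse (det (g x)) * det (C (g x)))"
    by (intro bigO_deriv_mult0 bigO_deriv_inverse[OF _ limdet] bigO_deriv_det metric_asymp) auto
  then show "bigO_deriv 1 0 (\<lambda>x. metric_inv g x $ i $ j)"
    by (rule bigO_deriv_cong[where R = R]) (use eq in auto)
  have "((\<lambda>x. C (g x) $ a $ b) \<longlongrightarrow> C (mat 1) $ a $ b) at_infinity" for a b
    using metric_asymp(2)[of a b] by (simp add: C_def)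
  then have "((\<lambda>x. inverse (det (g x)) * det (C (g x))) \<longlongrightarrow> inverse 1 * det (C (mat 1))) at_infinity"
    by (intro tendsto_mult tendsto_inverse limdet tendsto_det_3) auto
  \<comment> \<open>The limit just found is the cofactor formula at the identity matrix, so
    \<open>matrix_inv_cofactor\<close> read backwards evaluates it.\<close>
  moreover have "inverse 1 * det (C (mat 1)) = matrix_inv (mat 1) $ i $ j"
    by (simp add: matrix_inv_cofactor C_def)
  moreover have "matrix_inv (mat 1 :: real^3^3) = mat 1"
    using matrix_mul_matrix_inv[of "mat 1 :: real^3^3"] by simp
  ultimately have "((\<lambda>x. inverse (det (g x)) * det (C (g x))) \<longlongrightarrow> mat 1 $ i $ j) at_infinity"
    by metis
  then show "((\<lambda>x. metric_inv g x $ i $ j) \<longlongrightarrow> mat 1 $ i $ j) at_infinity"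
    by (rule Lim_transform_eventually)
       (rule eventually_mono[OF eventually_norm_greater[of R]], simp add: eq)
qed

lemma christoffel_smallo: "christoffel g a b c \<in> o[at_infinity](\<lambda>x. norm x powr -1)"
proof -
  have "(\<lambda>x. metric_inv g x $ a $ d *
     (partial b (\<lambda>y. g y $ d $ c) x + partial c (\<lambda>y. g y $ d $ b) x - partial d (\<lambda>y. g y $ b $ c) x))
     \<in> o[at_infinity](\<lambda>x. norm x powr 0 * norm x powr -1)" for d
    by (intro landau_o.big_small_mult bigO_derivD(1)[OF metric_inv_asymp(1)] sum_in_smallo metric_asymp(3))
  then have "(\<lambda>x. metric_inv g x $ a $ d *
     (partial b (\<lambda>y. g y $ d $ c) x + partial c (\<lambda>y. g y $ d $ b) x - partial d (\<lambda>y. g y $ b $ c) x))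
     \<in> o[at_infinity](\<lambda>x. norm x powr -1)" for d
    by (simp only: powr_add[symmetric]) simp
  from big_sum_in_smallo[OF this, where A = UNIV] have "(\<lambda>x. 1/2 * (\<Sum>d\<in>UNIV. metric_inv g x $ a $ d *
     (partial b (\<lambda>y. g y $ d $ c) x + partial c (\<lambda>y. g y $ d $ b) x - partial d (\<lambda>y. g y $ b $ c) x)))
     \<in> o[at_infinity](\<lambda>x. norm x powr -1)"
    by (simp only: landau_o.small.cmult_in_iff)
  then show ?thesis unfolding christoffel_def[abs_def] .
qed

text \<open>The metric and its inverse are O_1(1), so taking the trace and multiplying by the metric
  preserve the decay of \<open>k\<close>. This is also the source of the C^1 regularity used to
  differentiate the flux.\<close>

lemma conj_momentum_bigO_deriv:
  assumes "\<And>i j. bigO_deriv 1 (-p) (\<lambda>x. k x $ i $ j)"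
  shows "bigO_deriv 1 (-p) (\<lambda>x. conj_momentum g k x $ i $ j)"
proof -
  have "bigO_deriv 1 (-p) (metric_trace g k)"
    unfolding metric_trace_def[abs_def]
    by (intro bigO_deriv_sum bigO_deriv_mult0 metric_inv_asymp assms) auto
  from bigO_deriv_mult0[OF metric_asymp(1) this]
  have "bigO_deriv 1 (-p) (\<lambda>x. metric_trace g k x * g x $ i $ j)"
    by (simp only: mult.commute)
  from bigO_deriv_diff[OF assms this] show ?thesis by (simp add: conj_momentum_def)
qed

text \<open>Decay of J is assumed in the norm of the metric, but the divergence is estimated
  component by component. Near infinity the two sizes are comparable, because the inverse metric is
  close to the identity.\<close>

lemma component_bigo_covector_norm:
  "(\<lambda>x. w x $ j) \<in> O[at_infinity](covector_norm g w)"
proof (rule bigoI)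
  \<comment> \<open>Nine entries, each off by less than 1/18, change the quadratic form by at most
    half of the squared Euclidean norm.\<close>
  have "eventually (\<lambda>x. dist (metric_inv g x $ a $ b) (mat 1 $ a $ b) < 1/18) at_infinity" for a b
    by (rule tendstoD[OF metric_inv_asymp(2)]) simp
  then have "eventually (\<lambda>x. \<forall>a b. dist (metric_inv g x $ a $ b) (mat 1 $ a $ b) < 1/18) at_infinity"
    by (intro eventually_all_finite)
  then show "eventually (\<lambda>x. norm (w x $ j) \<le> 2 * norm (covector_norm g w x)) at_infinity"
  proof eventually_elim
    fix x
    assume close: "\<forall>a b. dist (metric_inv g x $ a $ b) (mat 1 $ a $ b) < 1/18"
    define E where "E a b = metric_inv g x $ a $ b - mat 1 $ a $ b" for a b
    define S where "S = (\<Sum>i\<in>UNIV. \<Sum>j\<in>UNIV. metric_inv g x $ i $ j * w x $ i * w x $ j)"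
    have "\<bar>E a b * w x $ a * w x $ b\<bar> \<le> 1/18 * (norm (w x))\<^sup>2" for a b
      unfolding abs_mult power2_eq_square mult.assoc
      using close by (intro mult_mono component_le_norm_cart) (auto simp: E_def dist_real_def less_imp_le)
    then have "\<bar>\<Sum>a\<in>UNIV. \<Sum>b\<in>UNIV. E a b * w x $ a * w x $ b\<bar> \<le> (\<Sum>a\<in>(UNIV::3 set). \<Sum>b\<in>(UNIV::3 set). 1/18 * (norm (w x))\<^sup>2)"
      by (intro order.trans[OF sum_abs] sum_mono) 
    moreover have "S = (\<Sum>a\<in>UNIV. \<Sum>b\<in>UNIV. mat 1 $ a $ b * w x $ a * w x $ b + E a b * w x $ a * w x $ b)"
      by (simp add: S_def E_def algebra_simps)
    moreover have "(\<Sum>a\<in>UNIV. \<Sum>b\<in>UNIV. mat 1 $ a $ b * w x $ a * w x $ b) = (norm (w x))\<^sup>2"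
      by (simp add: mat_def if_distrib if_distribR sum.delta power2_norm_eq_inner inner_vec_def cong: if_cong)
    ultimately have "(norm (w x))\<^sup>2 \<le> 2 * S" by (simp add: sum.distrib)
    \<comment> \<open>The preceding bound also shows that \<open>S\<close> is nonnegative, so
      \<open>sqrt S\<close> squares back to \<open>S\<close>. The factor 2 instead of the square
      root of 2 is slack.\<close>
    then have "(norm (w x))\<^sup>2 \<le> (2 * sqrt S)\<^sup>2"
      using order.trans[OF zero_le_power2, of "norm (w x)" "2 * S"] by (simp add: power_mult_distrib)
    then have "norm (w x) \<le> 2 * sqrt S"
      by (rule power2_le_imp_le) (use \<open>(norm (w x))\<^sup>2 \<le> 2 * S\<close> order.trans[OF zero_le_power2, of "norm (w x)" "2 * S"] in simp)
    moreover have "\<bar>w x $ j\<bar> \<le> norm (w x)" by (rule component_le_norm_cart)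
    ultimately show "norm (w x $ j) \<le> 2 * norm (covector_norm g w x)"
      unfolding covector_norm_def S_def[symmetric] real_norm_def by linarith
  qed
qed

text \<open>The Euclidean divergence is J minus two metric corrections. One replaces the inverse
  metric by the identity and costs o(1) times a derivative of the momentum; the other removes the
  Christoffel terms and costs o(1/r) times the momentum.\<close>

lemma flat_divergence_smallo:
  assumes k: "\<And>i j. bigO_deriv 1 (-p) (\<lambda>x. k x $ i $ j)"
    and J: "covector_norm g (current_density g k) \<in> o[at_infinity](\<lambda>x. norm x powr (-p - 1))"
  shows "(\<lambda>x. \<Sum>a\<in>UNIV. partial a (\<lambda>y. conj_momentum g k y $ a $ j) x)
           \<in> o[at_infinity](\<lambda>x. norm x powr (-p - 1))"
proof -
  let ?h = "conj_momentum g k"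
  let ?o = "o[at_infinity](\<lambda>x::real^3. norm x powr (-p - 1))"
  define \<Gamma> where "\<Gamma> a i j x = (\<Sum>d\<in>UNIV. christoffel g d a i x * ?h x $ d $ j + christoffel g d a j x * ?h x $ i $ d)" for a i j x
  note h = conj_momentum_bigO_deriv[OF k]
  have \<Gamma>h: "(\<lambda>x. christoffel g a b c x * ?h x $ i $ l) \<in> ?o" for a b c i l
    using landau_o.small_big_mult[OF christoffel_smallo bigO_derivD(1)[OF h], of a b c i l]
    by (simp only: powr_add[symmetric]) (simp only: add.commute[of "-1"] diff_conv_add_uminus)
  have "(\<lambda>x. \<Gamma> a i j x) \<in> ?o" for a i
    unfolding \<Gamma>_def by (intro big_sum_in_smallo sum_in_smallo \<Gamma>h)
  then have "(\<lambda>x. metric_inv g x $ a $ i * \<Gamma> a i j x) \<in> o[at_infinity](\<lambda>x. norm x powr 0 * norm x powr (-p - 1))" for a i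
    by (intro landau_o.big_small_mult bigO_derivD(1)[OF metric_inv_asymp(1)])
  then have 1: "(\<lambda>x. metric_inv g x $ a $ i * \<Gamma> a i j x) \<in> ?o" for a i
    by (simp only: powr_add[symmetric]) simp
  have "(\<lambda>x. metric_inv g x $ a $ i - mat 1 $ a $ i) \<in> o[at_infinity](\<lambda>x. 1)" for a i
    by (rule smalloI_tendsto) (use LIM_zero[OF metric_inv_asymp(2)] in auto)
  from landau_o.small_big_mult[OF this bigO_derivD(2)[OF h]]
  have 2: "(\<lambda>x. (metric_inv g x $ a $ i - mat 1 $ a $ i) * partial a (\<lambda>y. ?h y $ i $ j) x) \<in> ?o" for a i
    by simp
  have 3: "(\<lambda>x. current_density g k x $ j) \<in> ?o"
    by (rule landau_o.big_small_trans[OF component_bigo_covector_norm J])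
  have "(\<lambda>x. current_density g k x $ j - (\<Sum>a\<in>UNIV. \<Sum>i\<in>UNIV.
      (metric_inv g x $ a $ i - mat 1 $ a $ i) * partial a (\<lambda>y. ?h y $ i $ j) x
        - metric_inv g x $ a $ i * \<Gamma> a i j x)) \<in> ?o"
    by (intro sum_in_smallo big_sum_in_smallo 1 2 3)
  also have "(\<lambda>x. current_density g k x $ j - (\<Sum>a\<in>UNIV. \<Sum>i\<in>UNIV.
      (metric_inv g x $ a $ i - mat 1 $ a $ i) * partial a (\<lambda>y. ?h y $ i $ j) x
        - metric_inv g x $ a $ i * \<Gamma> a i j x))
     = (\<lambda>x. \<Sum>a\<in>UNIV. \<Sum>i\<in>UNIV. mat 1 $ a $ i * partial a (\<lambda>y. ?h y $ i $ j) x)"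
    by (simp add: fun_eq_iff current_density_def divergence_def covariant_deriv_def \<Gamma>_def[symmetric]
        left_diff_distrib right_diff_distrib sum_subtractf)
  also have "\<dots> = (\<lambda>x. \<Sum>a\<in>UNIV. partial a (\<lambda>y. ?h y $ a $ j) x)"
    by (simp add: mat_def if_distrib if_distribR sum.delta cong: if_cong)
  finally show ?thesis .
qed

end

section \<open>Flux through spheres\<close>

abbreviation angles :: "(real \<times> real) set" where
  "angles \<equiv> cbox (0, 0) (pi, 2 * pi)"

lemma spherical_nth [simp]:
  "spherical r (\<theta>, \<phi>) $ 1 = r * sin \<theta> * cos \<phi>"
  "spherical r (\<theta>, \<phi>) $ 2 = r * sin \<theta> * sin \<phi>"
  "spherical r (\<theta>, \<phi>) $ 3 = r * cos \<theta>"
  by (simp_all add: spherical_def)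

lemma norm_spherical [simp]: "norm (spherical r s) = \<bar>r\<bar>"
proof -
  obtain \<theta> \<phi> where s: "s = (\<theta>, \<phi>)" by fastforce
  have "(spherical r s $ 1)\<^sup>2 + (spherical r s $ 2)\<^sup>2 + (spherical r s $ 3)\<^sup>2
      = r\<^sup>2 * ((sin \<theta>)\<^sup>2 * ((cos \<phi>)\<^sup>2 + (sin \<phi>)\<^sup>2) + (cos \<theta>)\<^sup>2)"
    unfolding s spherical_nth by algebra
  also have "\<dots> = r\<^sup>2" by simp
  finally show ?thesis
    by (simp add: norm_vec_def L2_set_def sum_3)
qed

lemma spherical_eq_scaleR: "spherical r s = r *\<^sub>R spherical 1 s"
  by (cases s) (simp add: vec_eq_iff forall_3)

lemma continuous_on_spherical [continuous_intros]:
  fixes f :: "'b::t2_space \<Rightarrow> real"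
  assumes "continuous_on A f" "continuous_on A g"
  shows "continuous_on A (\<lambda>x. spherical (f x) (g x))"
proof -
  have "spherical r s = (\<chi> i. if i = 1 then r * sin (fst s) * cos (snd s)
      else if i = 2 then r * sin (fst s) * sin (snd s) else r * cos (fst s))" for r s
    by (cases s) (simp add: vec_eq_iff forall_3)
  moreover have "continuous_on A (\<lambda>x. if i = (1::3) then f x * sin (fst (g x)) * cos (snd (g x))
      else if i = 2 then f x * sin (fst (g x)) * sin (snd (g x)) else f x * cos (fst (g x)))" for i
    using assms by (cases i rule: exhaust_3[THEN disjE]) (auto intro!: continuous_intros)
  ultimately show ?thesis by (simp add: continuous_on_vec_lambda)
qed

text \<open>Replaces the push-forward measure by a gauge integral over a rectangle that does not
  depend on \<open>r\<close>, so that the flux can be differentiated under the integral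
  sign.\<close>

lemma integral_sphere_measure:
  fixes f :: "real^3 \<Rightarrow> real"
  assumes r: "0 \<le> r" and f: "continuous_on (sphere 0 r) f"
  shows "(\<integral>x. f x \<partial>sphere_measure r) =
    integral angles (\<lambda>s. r\<^sup>2 * sin (fst s) * f (spherical r s))"
proof -
  let ?M = "restrict_space lborel angles"
  let ?w = "\<lambda>s. r\<^sup>2 * sin (fst s)"
  have cs: "continuous_on angles (spherical r)"
    by (intro continuous_intros)
  have cf: "continuous_on angles (\<lambda>s. f (spherical r s))"
    by (rule continuous_on_compose2[OF f cs]) (use r in auto)
  have cw: "continuous_on angles ?w" by (intro continuous_intros)
  have meas: "h \<in> borel_measurable ?M" if "continuous_on angles h" for h :: "real \<times> real \<Rightarrow> real"
  proof -
    have "sets ?M = sets (restrict_space borel angles)"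
      by (rule sets_restrict_space_cong) simp
    then show ?thesis
      using borel_measurable_continuous_on_restrict[OF that] measurable_cong_sets by blast
  qed
  have ms: "spherical r \<in> measurable ?M (restrict_space borel (sphere 0 r))"
  proof (rule measurable_restrict_space2)
    have "sets ?M = sets (restrict_space borel angles)"
      by (rule sets_restrict_space_cong) simp
    then show "spherical r \<in> borel_measurable ?M"
      using borel_measurable_continuous_on_restrict[OF cs] measurable_cong_sets by blast
  qed (use r in auto)
  have "(\<integral>x. f x \<partial>sphere_measure r) = (\<integral>s. f (spherical r s) \<partial>(density ?M (\<lambda>s. ennreal (?w s))))"
    unfolding sphere_measure_def case_prod_beta
    by (rule integral_distr) (use ms borel_measurable_continuous_on_restrict[OF f] in auto)
  also have "\<dots> = (\<integral>s. ?w s *\<^sub>R f (spherical r s) \<partial>?M)"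
    \<comment> \<open>\<open>ennreal\<close> truncates negative values; none occur, since the sine
      is nonnegative for polar angles between 0 and pi.\<close>
    by (rule integral_density[OF meas[OF cf] meas[OF cw]])
       (auto simp: space_restrict_space intro!: AE_I2 mult_nonneg_nonneg sin_ge_zero)
  also have "\<dots> = (LINT s:angles|lborel. ?w s * f (spherical r s))"
    by (subst integral_restrict_space) (auto simp: set_lebesgue_integral_def)
  also have "\<dots> = integral angles (\<lambda>s. ?w s * f (spherical r s))"
    by (intro set_borel_integral_eq_integral borel_integrable_compact[unfolded set_integrable_def[symmetric]])
       (auto simp: set_integrable_def intro!: borel_integrable_compact continuous_on_mult cw cf)
  finally show ?thesis .
qed

lemma has_real_derivative_compose_partial:
  assumes f: "f differentiable (at (\<gamma> t))"
    and \<gamma>: "\<And>i. ((\<lambda>s. \<gamma> s $ i) has_real_derivative \<gamma>' i) (at t within S)"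
  shows "((\<lambda>s. f (\<gamma> s)) has_real_derivative (\<Sum>i\<in>UNIV. partial i f (\<gamma> t) * \<gamma>' i)) (at t within S)"
proof -
  have "(\<gamma> has_derivative (\<lambda>h. \<chi> i. h * \<gamma>' i)) (at t within S)"
    by (subst has_derivative_componentwise_within)
       (use \<gamma> in \<open>auto simp: Basis_vec_def inner_axis has_field_derivative_def mult.commute[of _ "\<gamma>' _"]\<close>)
  from has_derivative_compose[OF this has_derivative_partial[OF f]]
  show ?thesis
    unfolding has_field_derivative_def
    by (rule has_derivative_eq_rhs) (simp add: fun_eq_iff sum_distrib_left sum_distrib_right mult_ac)
qed

text \<open>Differentiating sine and cosine is a shift by \<open>pi / 2\<close>, so the unit tangent
  vectors are again values of \<open>spherical 1\<close>.\<close>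

lemma spherical_has_derivative:
  "((\<lambda>r. spherical r (\<theta>, \<phi>) $ i) has_real_derivative spherical 1 (\<theta>, \<phi>) $ i) (at r within S)"
  "((\<lambda>\<theta>. spherical r (\<theta>, \<phi>) $ i) has_real_derivative r * spherical 1 (\<theta> + pi / 2, \<phi>) $ i) (at \<theta> within S)"
  "((\<lambda>\<phi>. spherical r (\<theta>, \<phi>) $ i) has_real_derivative r * sin \<theta> * spherical 1 (pi / 2, \<phi> + pi / 2) $ i) (at \<phi> within S)"
  using exhaust_3[of i]
  by (auto intro!: derivative_eq_intros simp: sin_add cos_add)

text \<open>In the coordinate frame \<open>n\<close>, \<open>t\<close>, \<open>e\<close> of the sphere, which \<open>spherical\<close> produces from
  shifted angles, the divergence theorem for annuli reads: the radial derivative of the flux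
  density \<open>r\<^sup>2 sin \<theta> \<langle>V, n\<rangle>\<close> differs from \<open>r\<^sup>2 sin \<theta> div V\<close> by
  \<open>\<partial>\<^sub>\<theta>(r sin \<theta> \<langle>V, t\<rangle>) + \<partial>\<^sub>\<phi>(r \<langle>V, e\<rangle>)\<close>, whose integral vanishes.\<close>

lemma flux_has_derivative:
  fixes V :: "3 \<Rightarrow> real^3 \<Rightarrow> real"
  assumes R: "0 \<le> R" "R < r"
    and diff: "\<And>k x. R < norm x \<Longrightarrow> V k differentiable (at x)"
    and cont: "\<And>k i. continuous_on {x. R < norm x} (partial i (V k))"
  shows "((\<lambda>r. integral angles
        (\<lambda>s. r\<^sup>2 * sin (fst s) * (\<Sum>k\<in>UNIV. V k (spherical r s) * spherical 1 s $ k)))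
     has_real_derivative integral angles
        (\<lambda>s. r\<^sup>2 * sin (fst s) * (\<Sum>k\<in>UNIV. partial k (V k) (spherical r s)))) (at r)"
proof -
  define n where "n s = spherical 1 s" for s
  define t where "t s = spherical 1 (fst s + pi / 2, snd s)" for s
  define e where "e s = spherical 1 (pi / 2, snd s + pi / 2)" for s :: "real \<times> real"
  define v where "v k r s = V k (spherical r s)" for k r s
  define D where "D i k r s = partial i (V k) (spherical r s)" for i k r s
  define f where "f r s = r\<^sup>2 * sin (fst s) * (\<Sum>k\<in>UNIV. v k r s * n s $ k)" for r s
  define f' where "f' r s = 2 * r * sin (fst s) * (\<Sum>k\<in>UNIV. v k r s * n s $ k)
      + r\<^sup>2 * sin (fst s) * (\<Sum>k\<in>UNIV. (\<Sum>i\<in>UNIV. D i k r s * n s $ i) * n s $ k)" for r s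
  define P where "P r s = r * sin (fst s) * (\<Sum>k\<in>UNIV. v k r s * t s $ k)" for r s
  define P' where "P' r s = r * cos (fst s) * (\<Sum>k\<in>UNIV. v k r s * t s $ k)
      + r * sin (fst s) * (\<Sum>k\<in>UNIV. (\<Sum>i\<in>UNIV. D i k r s * (r * t s $ i)) * t s $ k - v k r s * n s $ k)" for r s
  define Q where "Q r s = r * (\<Sum>k\<in>UNIV. v k r s * e s $ k)" for r s
  \<comment> \<open>\<open>spherical 1 (pi / 2, snd s)\<close> is the horizontal radial unit vector;
    the azimuthal derivative of \<open>e\<close> is its negative.\<close>
  define Q' where "Q' r s = r * (\<Sum>k\<in>UNIV. (\<Sum>i\<in>UNIV. D i k r s * (r * sin (fst s) * e s $ i)) * e s $ k
      - v k r s * spherical 1 (pi / 2, snd s) $ k)" for r s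
  define d where "d r s = r\<^sup>2 * sin (fst s) * (\<Sum>k\<in>UNIV. D k k r s)" for r s

  have V_cont: "continuous_on {x. R < norm x} (V k)" for k
    by (rule differentiable_imp_continuous_outside) (use diff in auto)
  have vc: "continuous_on A (\<lambda>x. v k (\<rho> x) (\<sigma> x))"
    if "continuous_on A \<rho>" "continuous_on A \<sigma>" "\<And>x. x \<in> A \<Longrightarrow> R < \<rho> x"
    for A :: "'b::t2_space set" and \<rho> \<sigma> k
    unfolding v_def
    by (rule continuous_on_compose2[OF V_cont continuous_on_spherical[OF that(1,2)]]) (use that(3) in force)
  have Dc: "continuous_on A (\<lambda>x. D i k (\<rho> x) (\<sigma> x))"
    if "continuous_on A \<rho>" "continuous_on A \<sigma>" "\<And>x. x \<in> A \<Longrightarrow> R < \<rho> x"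
    for A :: "'b::t2_space set" and \<rho> \<sigma> i k
    unfolding D_def
    by (rule continuous_on_compose2[OF cont continuous_on_spherical[OF that(1,2)]]) (use that(3) in force)
  have vd: "V k differentiable (at (spherical \<rho> s))" if "R < \<rho>" for k \<rho> s
    using diff[of "spherical \<rho> s" k] that R by simp

  have f_der: "((\<lambda>\<rho>. f \<rho> s) has_real_derivative f' \<rho> s) (at \<rho> within U)" if "R < \<rho>" for \<rho> s U
  proof -
    obtain \<theta> \<phi> where s: "s = (\<theta>, \<phi>)" by fastforce
    have "((\<lambda>\<rho>. v k \<rho> s) has_real_derivative (\<Sum>i\<in>UNIV. D i k \<rho> s * n s $ i)) (at \<rho> within U)" for k
      unfolding v_def D_def n_def s
      by (rule has_real_derivative_compose_partial[OF vd[OF that] spherical_has_derivative(1)])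
    note [derivative_intros] = this
    show ?thesis
      unfolding f_def f'_def by (rule derivative_eq_intros refl)+ (simp add: algebra_simps)
  qed
  have P_der: "((\<lambda>\<theta>. P r (\<theta>, \<phi>)) has_real_derivative P' r (\<theta>, \<phi>)) (at \<theta> within U)" for \<theta> \<phi> U
  proof -
    have "((\<lambda>\<theta>. v k r (\<theta>, \<phi>)) has_real_derivative (\<Sum>i\<in>UNIV. D i k r (\<theta>, \<phi>) * (r * t (\<theta>, \<phi>) $ i))) (at \<theta> within U)" for k
      unfolding v_def D_def t_def fst_conv snd_conv
      by (rule has_real_derivative_compose_partial[OF vd[OF R(2)] spherical_has_derivative(2)])
    moreover have "((\<lambda>\<theta>. t (\<theta>, \<phi>) $ k) has_real_derivative - n (\<theta>, \<phi>) $ k) (at \<theta> within U)" for k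
      using exhaust_3[of k] unfolding t_def n_def
      by (auto intro!: derivative_eq_intros simp: sin_add cos_add)
    note [derivative_intros] = this calculation
    show ?thesis
      unfolding P_def P'_def fst_conv
      by (rule derivative_eq_intros refl)+ (simp add: algebra_simps sum.distrib sum_subtractf)
  qed
  have Q_der: "((\<lambda>\<phi>. Q r (\<theta>, \<phi>)) has_real_derivative Q' r (\<theta>, \<phi>)) (at \<phi> within U)" for \<theta> \<phi> U
  proof -
    have "((\<lambda>\<phi>. v k r (\<theta>, \<phi>)) has_real_derivative (\<Sum>i\<in>UNIV. D i k r (\<theta>, \<phi>) * (r * sin \<theta> * e (\<theta>, \<phi>) $ i))) (at \<phi> within U)" for k
      unfolding v_def D_def e_def fst_conv snd_conv
      by (rule has_real_derivative_compose_partial[OF vd[OF R(2)] spherical_has_derivative(3)])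
    moreover have "((\<lambda>\<phi>. e (\<theta>, \<phi>) $ k) has_real_derivative - spherical 1 (pi / 2, \<phi>) $ k) (at \<phi> within U)" for k
      using exhaust_3[of k] unfolding e_def
      by (auto intro!: derivative_eq_intros simp: sin_add cos_add)
    note [derivative_intros] = this calculation
    show ?thesis
      unfolding Q_def Q'_def fst_conv snd_conv
      by (rule derivative_eq_intros refl)+ (simp add: algebra_simps sum.distrib sum_subtractf)
  qed

  have split: "f' r s = d r s - P' r s - Q' r s" for s
  proof -
    obtain \<theta> \<phi> where s: "s = (\<theta>, \<phi>)" by fastforce
    \<comment> \<open>Completeness of the orthonormal frame: the derivative terms from the radial,
      polar and azimuthal directions add up to the trace of the derivative of \<open>V\<close>,
      which is the divergence.\<close>
    have frame: "n s $ i * n s $ k + t s $ i * t s $ k + e s $ i * e s $ k = (if i = k then 1 else 0)" for i k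
    proof -
      have "sin \<theta> * x * (sin \<theta> * y) + cos \<theta> * x * (cos \<theta> * y) = ((sin \<theta>)\<^sup>2 + (cos \<theta>)\<^sup>2) * (x * y)" for x y
        by algebra
      moreover have "cos \<phi> * cos \<phi> + sin \<phi> * sin \<phi> = 1" "sin \<phi> * sin \<phi> + cos \<phi> * cos \<phi> = 1"
        using sin_cos_squared_add3[of \<phi>] by linarith+
      ultimately show ?thesis
        using exhaust_3[of i] exhaust_3[of k] unfolding s n_def t_def e_def
        by (elim disjE; simp add: sin_add cos_add)
    qed
    \<comment> \<open>The undifferentiated \<open>V\<close> is paired with 2 r sin \<theta> n from
      \<open>f'\<close>, with r cos \<theta> t - r sin \<theta> n from \<open>P'\<close>, and with
      -r times the horizontal radial vector from \<open>Q'\<close>. This identity makes their sum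
      vanish.\<close>
    have conn: "sin \<theta> * n s $ k + cos \<theta> * t s $ k = spherical 1 (pi / 2, \<phi>) $ k" for k
    proof -
      have "sin \<theta> * (sin \<theta> * x) + cos \<theta> * (cos \<theta> * x) = ((sin \<theta>)\<^sup>2 + (cos \<theta>)\<^sup>2) * x" for x
        by algebra
      then show ?thesis
        using exhaust_3[of k] unfolding s n_def t_def
        by (elim disjE; simp add: sin_add cos_add)
    qed
    have "f' r s + P' r s + Q' r s
      = r\<^sup>2 * sin \<theta> * (\<Sum>k\<in>UNIV. \<Sum>i\<in>UNIV. D i k r s *
            (n s $ i * n s $ k + t s $ i * t s $ k + e s $ i * e s $ k))
        + r * (\<Sum>k\<in>UNIV. v k r s *
            (sin \<theta> * n s $ k + cos \<theta> * t s $ k - spherical 1 (pi / 2, \<phi>) $ k))"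
      unfolding f'_def P'_def Q'_def sum_3 s fst_conv snd_conv by algebra
    also have "\<dots> = d r s"
      unfolding frame conn d_def by (simp add: s if_distrib sum.delta' cong: if_cong)
    finally show ?thesis by simp
  qed

  have cont': "continuous_on angles (P' r)" "continuous_on angles (Q' r)" "continuous_on angles (d r)"
    unfolding P'_def Q'_def d_def n_def t_def e_def
    using R by (intro continuous_intros vc Dc; simp)+

  \<comment> \<open>\<open>P\<close> carries the factor sin \<theta>, which is zero at both
    poles.\<close>
  have P0: "integral angles (P' r) = 0"
  proof -
    have inner: "integral (cbox 0 pi) (\<lambda>\<theta>. P' r (\<theta>, \<phi>)) = 0" for \<phi>
    proof -
      have "((\<lambda>\<theta>. P' r (\<theta>, \<phi>)) has_integral P r (pi, \<phi>) - P r (0, \<phi>)) {0..pi}"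
        by (rule fundamental_theorem_of_calculus)
           (auto simp: has_real_derivative_iff_has_vector_derivative[symmetric] P_der)
      then show ?thesis by (auto simp: P_def dest: integral_unique)
    qed
    have "integral angles (P' r) = integral (cbox 0 pi) (\<lambda>\<theta>. integral (cbox 0 (2 * pi)) (\<lambda>\<phi>. P' r (\<theta>, \<phi>)))"
      by (rule integral_prod_continuous[OF cont'(1)])
    \<comment> \<open>The order is exchanged because the fundamental theorem applies to
      \<open>P'\<close> in the polar angle, which has to be the inner variable.\<close>
    also have "\<dots> = integral (cbox 0 (2 * pi)) (\<lambda>\<phi>. integral (cbox 0 pi) (\<lambda>\<theta>. P' r (\<theta>, \<phi>)))"
      by (rule integral_swap_continuous) (use cont'(1) in simp)
    also have "\<dots> = 0" unfolding inner by simp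
    finally show ?thesis .
  qed
  \<comment> \<open>\<open>Q\<close> takes the same value at azimuths 0 and \<open>2 * pi\<close>,
    and here the azimuth already is the inner variable.\<close>
  have Q0: "integral angles (Q' r) = 0"
  proof -
    have inner: "integral (cbox 0 (2 * pi)) (\<lambda>\<phi>. Q' r (\<theta>, \<phi>)) = 0" for \<theta>
    proof -
      have "((\<lambda>\<phi>. Q' r (\<theta>, \<phi>)) has_integral Q r (\<theta>, 2 * pi) - Q r (\<theta>, 0)) {0..2 * pi}"
        by (rule fundamental_theorem_of_calculus)
           (auto simp: has_real_derivative_iff_has_vector_derivative[symmetric] Q_der)
      moreover have per: "spherical \<rho> (\<theta>', 2 * pi + \<phi>) = spherical \<rho> (\<theta>', \<phi>)" for \<rho> \<theta>' \<phi>
        by (simp add: vec_eq_iff forall_3 sin_add cos_add)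
      then have "spherical r (\<theta>, 2 * pi) = spherical r (\<theta>, 0)" "e (\<theta>, 2 * pi) = e (\<theta>, 0)"
        using per[of r \<theta> 0] per[of 1 "pi / 2" "pi / 2"] by (simp_all add: e_def)
      ultimately show ?thesis by (auto simp: Q_def v_def dest: integral_unique)
    qed
    have "integral angles (Q' r) = integral (cbox 0 pi) (\<lambda>\<theta>. integral (cbox 0 (2 * pi)) (\<lambda>\<phi>. Q' r (\<theta>, \<phi>)))"
      by (rule integral_prod_continuous[OF cont'(2)])
    also have "\<dots> = 0" unfolding inner by simp
    finally show ?thesis .
  qed

  \<comment> \<open>The Leibniz rule works within a convex set of radii. The half-line is also open,
    so the result is an ordinary derivative at \<open>r\<close>.\<close>
  have "((\<lambda>\<rho>. integral angles (f \<rho>)) has_real_derivative integral angles (f' r)) (at r within {R<..})"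
  proof (rule leibniz_rule_field_derivative)
    show "f \<rho> integrable_on angles" if "\<rho> \<in> {R<..}" for \<rho>
      unfolding f_def n_def using that
      by (intro integrable_continuous continuous_intros vc) auto
    show "continuous_on ({R<..} \<times> angles) (\<lambda>(\<rho>, s). f' \<rho> s)"
      unfolding f'_def n_def case_prod_beta
      by (intro continuous_intros vc Dc) auto
  qed (use f_der R in auto)
  also have "integral angles (f' r) = integral angles (d r) - integral angles (P' r) - integral angles (Q' r)"
    unfolding split
    by (simp add: integral_diff integrable_diff integrable_continuous[OF cont'(1)]
        integrable_continuous[OF cont'(2)] integrable_continuous[OF cont'(3)])
  also have "\<dots> = integral angles (d r)" using P0 Q0 by simp
  also have "at r within {R<..} = at r"
    by (rule at_within_open) (use R in auto)
  finally show ?thesis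
    by (simp add: f_def d_def v_def D_def n_def)
qed

section \<open>Convergence\<close>

text \<open>Doubling the radius changes A r^m by a fixed multiple of its own size, while r times
  o(r^(m-1)) is only o(r^m) and the convergent rest changes by o(1).\<close>

lemma tendsto_if_derivative_smallo:
  fixes I I' :: "real \<Rightarrow> real"
  assumes m: "0 < m"
    and der: "\<And>r. R < r \<Longrightarrow> (I has_real_derivative I' r) (at r)"
    and small: "I' \<in> o[at_top](\<lambda>r. r powr (m - 1))"
    and lim: "((\<lambda>r. I r - A * r powr m) \<longlongrightarrow> B) at_top"
  shows "(I \<longlongrightarrow> B) at_top"
proof -
  have "A = 0"
  proof (rule ccontr)
    assume A: "A \<noteq> 0"
    have two: "1 < (2::real) powr m" using m by simp
    \<comment> \<open>\<open>\<delta>\<close> is half of the relative increment of A r^m from r to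
      2r. The division by \<open>2 powr m\<close> in \<open>\<eta>\<close> compensates for
      \<open>\<xi> powr m\<close> being as large as \<open>(2 * r) powr m\<close>.\<close>
    define \<delta> where "\<delta> = \<bar>A\<bar> * (2 powr m - 1) / 2"
    define \<eta> where "\<eta> = \<delta> / 2 powr m"
    have \<delta>: "0 < \<delta>" and \<eta>: "0 < \<eta>" using A two by (simp_all add: \<delta>_def \<eta>_def)
    obtain S where S: "\<And>r. S \<le> r \<Longrightarrow> \<bar>I' r\<bar> \<le> \<eta> * \<bar>r powr (m - 1)\<bar>"
      using landau_o.smallD[OF small \<eta>] by (auto simp: eventually_at_top_linorder)
    define d where "d r = (I (2 * r) - A * (2 * r) powr m) - (I r - A * r powr m)" for r
    have "filterlim (\<lambda>r::real. 2 * r) at_top at_top"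
      by (rule filterlim_tendsto_pos_mult_at_top[OF tendsto_const]) (auto simp: filterlim_ident)
    from tendsto_diff[OF filterlim_compose[OF lim this] lim]
    have "(d \<longlongrightarrow> 0) at_top" by (simp add: d_def[abs_def])
    then have "eventually (\<lambda>r. \<bar>d r\<bar> < \<delta>) at_top"
      using tendstoD[of d 0 at_top \<delta>] \<delta> by (simp add: dist_real_def)
    moreover have "eventually (\<lambda>r. max (max R S) 1 < r) at_top"
      by (rule eventually_gt_at_top)
    ultimately have "eventually (\<lambda>r. \<bar>d r\<bar> < \<delta> \<and> max (max R S) 1 < r) at_top"
      by (rule eventually_conj)
    then obtain r where dr: "\<bar>d r\<bar> < \<delta>" and r: "R < r" "S < r" "1 < r"
      using eventually_happens'[OF trivial_limit_at_top_linorder] by fastforce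
    have "\<exists>\<xi>>r. \<xi> < 2 * r \<and> I (2 * r) - I r = (2 * r - r) * I' \<xi>"
      using r by (intro MVT2) (auto intro: der)
    then obtain \<xi> where \<xi>: "r < \<xi>" "\<xi> < 2 * r" "I (2 * r) - I r = r * I' \<xi>" by auto
    have "\<bar>I (2 * r) - I r\<bar> \<le> r * (\<eta> * \<xi> powr (m - 1))"
      using S[of \<xi>] r \<xi> by (simp add: abs_mult)
    \<comment> \<open>The sign of \<open>m - 1\<close> is unknown, so that power has no known
      monotonicity. Splitting off 1/\<xi>, which is below 1/r, leaves the increasing power
      \<open>m\<close>.\<close>
    also have "\<dots> = \<eta> * (r * (\<xi> powr m / \<xi>))"
      using r \<xi> by (simp add: powr_diff)
    also have "\<dots> \<le> \<eta> * (\<xi> powr m)"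
      using \<eta> \<xi> r by (intro mult_left_mono) (simp_all add: field_simps)
    also have "\<dots> \<le> \<eta> * (2 * r) powr m"
      using \<eta> \<xi> r m by (intro mult_left_mono powr_mono2) auto
    also have "\<dots> = \<delta> * r powr m"
      using r by (simp add: \<eta>_def powr_mult)
    finally have 1: "\<bar>I (2 * r) - I r\<bar> \<le> \<delta> * r powr m" .
    have "I (2 * r) - I r - d r = A * (2 powr m - 1) * r powr m"
      using r by (simp add: d_def powr_mult algebra_simps)
    then have "\<bar>I (2 * r) - I r - d r\<bar> = 2 * \<delta> * r powr m"
      using two by (simp add: \<delta>_def abs_mult)
    \<comment> \<open>As r > 1, the error \<open>\<bar>d r\<bar> < \<delta>\<close> is also below
      \<open>\<delta> * r powr m\<close>, so the total stays strictly under the required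
      \<open>2 * \<delta> * r powr m\<close>.\<close>
    moreover have "\<delta> * 1 \<le> \<delta> * r powr m"
      using \<delta> r m by (intro mult_left_mono ge_one_powr_ge_zero) auto
    ultimately show False using 1 dr by linarith
  qed
  with lim show ?thesis by simp
qed

lemma sphere_integral_bound:
  assumes "0 \<le> C" "0 \<le> r" "continuous_on {x. R < norm x} W" "R < r" "\<And>x. norm x = r \<Longrightarrow> \<bar>W x\<bar> \<le> C"
  shows "\<bar>integral angles (\<lambda>s. r\<^sup>2 * sin (fst s) * W (spherical r s))\<bar> \<le> measure lborel angles * r\<^sup>2 * C"
proof -
  have c: "continuous_on angles (\<lambda>s. W (spherical r s))"
    by (rule continuous_on_compose2[OF assms(3)]) (use assms in \<open>auto intro!: continuous_intros\<close>)
  have "norm (integral angles (\<lambda>s. r\<^sup>2 * sin (fst s) * W (spherical r s))) \<le> (r\<^sup>2 * C) * measure lborel angles"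
  proof (rule integrable_bound)
    show "norm (r\<^sup>2 * sin (fst s) * W (spherical r s)) \<le> r\<^sup>2 * C" for s
    proof -
      have "\<bar>sin (fst s)\<bar> * \<bar>W (spherical r s)\<bar> \<le> 1 * C"
        using assms by (intro mult_mono) auto
      then show ?thesis
        by (simp add: abs_mult mult.assoc mult_left_mono)
    qed
    show "(\<lambda>s. r\<^sup>2 * sin (fst s) * W (spherical r s)) integrable_on angles"
      by (intro integrable_continuous continuous_intros c)
  qed (use assms in auto)
  then show ?thesis by (simp add: mult_ac)
qed

text \<open>The two additional powers of \<open>r\<close> come from the area element.\<close>

lemma sphere_integral_smallo:
  assumes R: "0 \<le> R" and cont: "continuous_on {x. R < norm x} W"
    and small: "W \<in> o[at_infinity](\<lambda>x. norm x powr a)"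
  shows "(\<lambda>r. integral angles (\<lambda>s. r\<^sup>2 * sin (fst s) * W (spherical r s))) \<in> o[at_top](\<lambda>r. r powr (a + 2))"
proof (rule landau_o.smallI)
  fix c :: real assume c: "0 < c"
  define v where "v = measure lborel angles"
  \<comment> \<open>Adding 1 makes the denominator positive without evaluating \<open>v\<close>, and
    still leaves \<open>v * \<eta> \<le> c\<close>.\<close>
  define \<eta> where "\<eta> = c / (v + 1)"
  have "0 \<le> v" unfolding v_def by (rule content_pos_le)
  then have \<eta>: "0 < \<eta>" "v * \<eta> \<le> c"
    using c by (simp_all add: \<eta>_def field_simps)
  obtain S where S: "\<And>x. S \<le> norm x \<Longrightarrow> \<bar>W x\<bar> \<le> \<eta> * norm x powr a"
    using landau_o.smallD[OF small \<eta>(1)] by (auto simp: eventually_at_infinity)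
  have "eventually (\<lambda>r. max R S < r) at_top" by (rule eventually_gt_at_top)
  then show "eventually (\<lambda>r. norm (integral angles (\<lambda>s. r\<^sup>2 * sin (fst s) * W (spherical r s)))
      \<le> c * norm (r powr (a + 2))) at_top"
  proof eventually_elim
    case (elim r)
    then have r: "0 < r" "R < r" "S < r" using R by auto
    have "\<bar>integral angles (\<lambda>s. r\<^sup>2 * sin (fst s) * W (spherical r s))\<bar> \<le> v * r\<^sup>2 * (\<eta> * r powr a)"
      unfolding v_def by (rule sphere_integral_bound[OF _ _ cont]) (use r \<eta> S in auto)
    also have "\<dots> = (v * \<eta>) * r powr (a + 2)"
      using r by (simp add: powr_add mult_ac)
    also have "\<dots> \<le> c * r powr (a + 2)"
      using \<eta> by (intro mult_right_mono) auto
    finally show ?case by simp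
  qed
qed

text \<open>Comparing two radii expresses \<open>b\<close> and \<open>c\<close> through the continuous \<open>F\<close> and \<open>W\<close>, which makes
  them integrable over the sphere.\<close>

lemma sphere_integral_expansion:
  assumes m: "0 < m" and R: "0 \<le> R"
    and F: "continuous_on {x. R < norm x} F" and W: "continuous_on {x. R < norm x} W"
    and small: "W \<in> o[at_infinity](\<lambda>x. norm x powr -2)"
    and eq: "\<And>x. R < norm x \<Longrightarrow>
       F x = norm x powr (m - 2) * b (x /\<^sub>R norm x) + norm x powr -2 * c (x /\<^sub>R norm x) + W x"
  shows "\<exists>A B. ((\<lambda>r. integral angles (\<lambda>s. r\<^sup>2 * sin (fst s) * F (spherical r s)) - A * r powr m) \<longlongrightarrow> B) at_top"
proof -
  define f where "f r s = r\<^sup>2 * sin (fst s) * F (spherical r s)" for r s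
  define w where "w r s = r\<^sup>2 * sin (fst s) * W (spherical r s)" for r s
  define \<beta> where "\<beta> s = sin (fst s) * b (spherical 1 s)" for s
  define \<gamma> where "\<gamma> s = sin (fst s) * c (spherical 1 s)" for s
  have f_eq: "f r s = r powr m * \<beta> s + \<gamma> s + w r s" if "R < r" for r s
  proof -
    have r: "0 < r" using that R by simp
    have "spherical r s /\<^sub>R r = spherical 1 s"
      using r by (subst spherical_eq_scaleR) simp
    moreover have "r\<^sup>2 * r powr (m - 2) = r powr m" "r\<^sup>2 * r powr - 2 = 1"
      using r by (simp_all add: powr_diff powr_minus)
    ultimately have "r\<^sup>2 * F (spherical r s) = r powr m * b (spherical 1 s) + c (spherical 1 s) + r\<^sup>2 * W (spherical r s)"
      using eq[of "spherical r s"] that r by (simp add: distrib_left mult.assoc[symmetric])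
    then have "sin (fst s) * (r\<^sup>2 * F (spherical r s)) = sin (fst s) * (r powr m * b (spherical 1 s) + c (spherical 1 s) + r\<^sup>2 * W (spherical r s))"
      by simp
    then show ?thesis by (simp add: f_def w_def \<beta>_def \<gamma>_def algebra_simps)
  qed
  have cont: "continuous_on angles (f r)" "continuous_on angles (w r)" if "R < r" for r
    unfolding f_def w_def
    by (intro continuous_intros continuous_on_compose2[OF F] continuous_on_compose2[OF W];
        use that in force)+
  \<comment> \<open>Any two distinct radii beyond \<open>R\<close> serve: since \<open>m\<close> is
    positive their powers differ, and the two linear equations for \<open>\<beta>\<close> and
    \<open>\<gamma>\<close> can be solved.\<close>
  define r1 where "r1 = R + 1"
  define r2 where "r2 = R + 2"
  have r12: "R < r1" "R < r2" "r1 powr m < r2 powr m"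
    using R m by (auto simp: r1_def r2_def intro!: powr_less_mono2)
  have "continuous_on angles (\<lambda>s. ((f r2 s - w r2 s) - (f r1 s - w r1 s)) / (r2 powr m - r1 powr m))"
    using r12 by (intro continuous_intros cont) auto
  then have \<beta>: "continuous_on angles \<beta>"
    by (rule continuous_on_eq) (use r12 in \<open>simp add: f_eq field_simps\<close>)
  have "continuous_on angles (\<lambda>s. f r1 s - w r1 s - r1 powr m * \<beta> s)"
    using r12 by (intro continuous_intros cont \<beta>) auto
  then have \<gamma>: "continuous_on angles \<gamma>"
    by (rule continuous_on_eq) (use r12 in \<open>simp add: f_eq\<close>)
  note int = integrable_continuous[OF \<beta>] integrable_continuous[OF \<gamma>]
  have "(\<lambda>r. integral angles (w r)) \<in> o[at_top](\<lambda>r. r powr (-2 + 2))"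
    unfolding w_def by (rule sphere_integral_smallo[OF R W small])
  then have "((\<lambda>r. integral angles (w r) / r powr (-2 + 2)) \<longlongrightarrow> 0) at_top"
    by (rule smalloD_tendsto)
  then have "((\<lambda>r. integral angles (w r)) \<longlongrightarrow> 0) at_top"
    by (rule Lim_transform_eventually) (rule eventually_mono[OF eventually_gt_at_top[of 0]], simp)
  from tendsto_add[OF tendsto_const this]
  have "((\<lambda>r. integral angles \<gamma> + integral angles (w r)) \<longlongrightarrow> integral angles \<gamma>) at_top"
    by simp
  then have "((\<lambda>r. integral angles (f r) - integral angles \<beta> * r powr m) \<longlongrightarrow> integral angles \<gamma>) at_top"
  proof (rule Lim_transform_eventually)
    show "eventually (\<lambda>r. integral angles \<gamma> + integral angles (w r)
        = integral angles (f r) - integral angles \<beta> * r powr m) at_top"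
    proof (rule eventually_mono[OF eventually_gt_at_top[of R]])
      fix r assume r: "R < r"
      have "integral angles (f r) = integral angles (\<lambda>s. r powr m * \<beta> s + \<gamma> s + w r s)"
        using f_eq[OF r] by (intro integral_cong) simp
      also have "\<dots> = r powr m * integral angles \<beta> + integral angles \<gamma> + integral angles (w r)"
        using int integrable_continuous[OF cont(2)[OF r]]
        by (simp add: integral_add integrable_add integrable_on_mult_right)
      finally show "integral angles \<gamma> + integral angles (w r)
        = integral angles (f r) - integral angles \<beta> * r powr m" by simp
    qed
  qed
  then show ?thesis unfolding f_def by blast
qed

section \<open>Rotation fields and the flux of the momentum tensor\<close>

lemma rotation_field_matrix:
  obtains M :: "real^3^3" where "\<And>x. rotation_field i x = M *v x" "\<And>j k. M $ j $ k = - M $ k $ j"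
proof
  let ?M = "matrix (rotation_field i)"
  have "linear (rotation_field i)"
    unfolding rotation_field_def by (simp add: linear_iff cross_add_right cross_mult_right)
  then show "rotation_field i x = ?M *v x" for x
    by (simp add: matrix_works)
  \<comment> \<open>Skew-symmetry is the Killing equation for a linear field: the pairing of its
    gradient with a symmetric tensor vanishes.\<close>
  show "?M $ j $ k = - ?M $ k $ j" for j k
    using exhaust_3[of i] exhaust_3[of j] exhaust_3[of k]
    by (elim disjE; simp add: matrix_def rotation_field_def cross3_def axis_def)
qed

lemma partial_matrix_vector: "partial k (\<lambda>x. (M *v x) $ j) x = (M :: real^3^3) $ j $ k"
proof -
  have "((\<lambda>x. (M *v x) $ j) has_derivative (\<lambda>x. (M *v x) $ j)) (at x)"
    by (intro bounded_linear_imp_has_derivative bounded_linear_compose[OF bounded_linear_vec_nth]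
        matrix_vector_mul_bounded_linear)
  from partial_eqI[OF this] show ?thesis
    by (simp add: matrix_vector_mul_component inner_axis)
qed

lemma bigO_deriv_matrix_vector: "bigO_deriv 1 1 (\<lambda>x. ((M :: real^3^3) *v x) $ j)"
proof -
  have bl: "bounded_linear (\<lambda>x. (M *v x) $ j)"
    by (intro bounded_linear_compose[OF bounded_linear_vec_nth] matrix_vector_mul_bounded_linear)
  then obtain C where "\<And>x. norm ((M *v x) $ j) \<le> norm x * C"
    using bounded_linear.bounded by blast
  then have "(\<lambda>x. (M *v x) $ j) \<in> O[at_infinity](\<lambda>x. norm x powr 1)"
    by (intro bigoI[of _ C]) (auto simp: mult.commute)
  moreover have "(\<lambda>x. M $ j $ k) \<in> O[at_infinity](\<lambda>x::real^3. norm x powr (1 - 1))" for k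
    using bigO_derivD(1)[OF bigO_deriv_const] by simp
  moreover have "(\<lambda>x. (M *v x) $ j) differentiable (at x)" for x
    using bounded_linear_imp_differentiable[OF bl] .
  ultimately show ?thesis
    unfolding bigO_deriv_1_iff partial_matrix_vector[abs_def] by auto
qed

lemma smallo_derivD:
  assumes "smallo_deriv 1 a f"
  shows "f \<in> o[at_infinity](\<lambda>x. norm x powr a)" "\<exists>R. continuous_on {x. R < norm x} f"
proof -
  show "f \<in> o[at_infinity](\<lambda>x. norm x powr a)"
    using assms unfolding smallo_deriv_def by (auto dest: spec[of _ "[]"])
  obtain R where "Ck_on 1 f {x. R < norm x}"
    using assms unfolding smallo_deriv_def by blast
  then have "continuous_on {x. R < norm x} f"
    by (intro differentiable_imp_continuous_outside) auto
  then show "\<exists>R. continuous_on {x. R < norm x} f" ..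
qed

text \<open>Regularity is given for each component outside its own ball. There are nine components,
  so the largest radius serves them all.\<close>

lemma common_radius:
  fixes Q :: "3 \<Rightarrow> 3 \<Rightarrow> real \<Rightarrow> bool"
  assumes "\<And>i j. \<exists>R. Q i j R" "\<And>i j R S. Q i j R \<Longrightarrow> R \<le> S \<Longrightarrow> Q i j S"
  obtains R where "R0 \<le> R" "\<And>i j. Q i j R"
proof -
  obtain \<rho> where \<rho>: "\<And>i j. Q i j (\<rho> i j)" using assms(1) by metis
  define R where "R = Max (insert R0 (range (\<lambda>(i, j). \<rho> i j)))"
  have "R0 \<le> R" unfolding R_def by (rule Max_ge) auto
  moreover have "\<rho> i j \<le> R" for i j
    unfolding R_def by (rule Max_ge) (auto intro!: rev_image_eqI[of "(i, j)"])
  ultimately show thesis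
    using \<rho> assms(2) that by blast
qed

text \<open>The geometry enters only through the Euclidean divergence of a symmetric matrix field.
  The exponent m = 3 - p collects r^(-p) from the tensor, r from the rotation field and r^2 from the
  area.\<close>

lemma angular_momentum_converges:
  assumes p: "p < 3"
    and h: "\<And>i j. bigO_deriv 1 (-p) (\<lambda>x. h x $ i $ j)"
    and sym: "\<And>x. R0 < norm x \<Longrightarrow> transpose (h x) = h x"
    and div: "\<And>j. (\<lambda>x. \<Sum>a\<in>UNIV. partial a (\<lambda>y. h y $ a $ j) x) \<in> o[at_infinity](\<lambda>x. norm x powr (-p - 1))"
    and ex: "momentum_expansion p h b c"
  shows "\<exists>L. (angular_momentum_at h (rotation_field l) \<longlongrightarrow> L) at_top"
proof -
  obtain M :: "real^3^3" where M: "\<And>x. rotation_field l x = M *v x" "\<And>j k. M $ j $ k = - M $ k $ j"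
    by (rule rotation_field_matrix[of l]) blast
  define e where "e j k x = h x $ j $ k
        - (b (x /\<^sub>R norm x) $ j $ k * norm x powr (-p) + c (x /\<^sub>R norm x) $ j $ k * norm x powr (-3))" for j k x
  have e: "smallo_deriv 1 (-3) (e j k)" for j k
    using ex unfolding momentum_expansion_def e_def[abs_def] by blast
  have outside_mono: "continuous_on {x. S < norm x} f"
    if "continuous_on {x. R < norm x} f" "R \<le> S" for f :: "real^3 \<Rightarrow> real" and R S
    by (rule continuous_on_subset[OF that(1)]) (use that(2) in auto)
  obtain R1 where R1: "max R0 0 \<le> R1" "\<And>j k. continuous_on {x. R1 < norm x} (e j k)"
  proof (rule common_radius[of "\<lambda>j k R. continuous_on {x. R < norm x} (e j k)" "max R0 0",
        OF smallo_derivD(2)[OF e] outside_mono])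
    fix R
    assume "max R0 0 \<le> R" "\<And>j k. continuous_on {x. R < norm x} (e j k)"
    then show thesis by (rule that)
  qed
  define C1_outside where "C1_outside f R \<longleftrightarrow> (\<forall>x. R < norm x \<longrightarrow> f differentiable (at x)) \<and>
          (\<forall>i. continuous_on {x. R < norm x} (partial i f))" for f R
  have C1_mono: "C1_outside f S" if "C1_outside f R" "R \<le> S" for f R S
    using that outside_mono[OF _ that(2)] unfolding C1_outside_def by auto
  have C1_ex: "\<exists>R. C1_outside (\<lambda>x. h x $ j $ k) R" for j k
    using bigO_derivD(3)[OF h] unfolding C1_outside_def .
  obtain R where R: "R1 \<le> R" "\<And>j k. C1_outside (\<lambda>x. h x $ j $ k) R"
  proof (rule common_radius[of "\<lambda>j k. C1_outside (\<lambda>x. h x $ j $ k)" R1, OF C1_ex C1_mono])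
    fix R
    assume "R1 \<le> R" "\<And>j k. C1_outside (\<lambda>x. h x $ j $ k) R"
    then show thesis by (rule that)
  qed
  have R0: "0 \<le> R" "R0 \<le> R" using R R1 by auto
  have h_diff: "(\<lambda>x. h x $ j $ k) differentiable (at x)" if "R < norm x" for j k x
    using R(2) that unfolding C1_outside_def by blast
  have h_cont: "continuous_on {x. R < norm x} (\<lambda>x. h x $ j $ k)" for j k
    by (rule differentiable_imp_continuous_outside) (use h_diff in auto)
  have e_cont: "continuous_on {x. R < norm x} (e j k)" for j k
    by (rule outside_mono[OF R1(2) R(1)])

  let ?Y = "\<lambda>j x. (M *v x) $ j"
  note Y = bigO_derivD(1)[OF bigO_deriv_matrix_vector[of M]]
  have Y_diff: "?Y j differentiable (at x)" for j x
    by (intro bounded_linear_imp_differentiable bounded_linear_compose[OF bounded_linear_vec_nth]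
        matrix_vector_mul_bounded_linear)
  have Y_cont: "continuous_on A (?Y j)" for j A
    by (intro continuous_at_imp_continuous_on ballI differentiable_imp_continuous_within Y_diff)
  have u: "(\<lambda>x::real^3. x $ k / norm x) \<in> O[at_infinity](\<lambda>x. 1)" for k
    by (rule bigoI[of _ 1], rule eventually_mono[OF eventually_norm_greater[of 0]])
       (simp add: component_le_norm_cart)
  have u_cont: "continuous_on {x. R < norm x} (\<lambda>x::real^3. x $ k / norm x)" for k
    by (intro continuous_intros) (use R0 in auto)

  \<comment> \<open>\<open>V\<close> is the tensor contracted with the rotation field,
    \<open>F\<close> its normal component on spheres, and \<open>W\<close> the share of the
    remainder \<open>e\<close> in \<open>F\<close>.\<close>
  define V where "V k x = (\<Sum>j\<in>UNIV. h x $ j $ k * ?Y j x)" for k x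
  define F where "F x = (\<Sum>j\<in>UNIV. \<Sum>k\<in>UNIV. h x $ j $ k * ?Y j x * (x $ k / norm x))" for x
  define W where "W x = (\<Sum>j\<in>UNIV. \<Sum>k\<in>UNIV. e j k x * ?Y j x * (x $ k / norm x))" for x
  define I where "I r = integral angles (\<lambda>s. r\<^sup>2 * sin (fst s) * F (spherical r s))" for r

  have V_partial: "partial i (V k) x = (\<Sum>j\<in>UNIV. h x $ j $ k * M $ j $ i + partial i (\<lambda>x. h x $ j $ k) x * ?Y j x)"
    if "R < norm x" for i k x
  proof -
    have "partial i (V k) x = (\<Sum>j\<in>UNIV. partial i (\<lambda>x. h x $ j $ k * ?Y j x) x)"
      unfolding V_def[abs_def] sum_3
      by (simp add: partial_add h_diff[OF that] Y_diff)
    then show ?thesis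
      by (simp add: partial_mult h_diff[OF that] Y_diff partial_matrix_vector)
  qed
  have V_diff: "V k differentiable (at x)" if "R < norm x" for k x
    unfolding V_def[abs_def] by (intro differentiable_sum ballI differentiable_mult h_diff[OF that] Y_diff) auto
  have V_cont: "continuous_on {x. R < norm x} (partial i (V k))" for i k
    by (rule continuous_on_eq[of _ "\<lambda>x. (\<Sum>j\<in>UNIV. h x $ j $ k * M $ j $ i + partial i (\<lambda>x. h x $ j $ k) x * ?Y j x)"])
       (use R(2) in \<open>auto intro!: continuous_intros h_cont Y_cont simp: V_partial C1_outside_def\<close>)
  have divV: "(\<Sum>k\<in>UNIV. partial k (V k) x) = (\<Sum>j\<in>UNIV. (\<Sum>k\<in>UNIV. partial k (\<lambda>y. h y $ k $ j) x) * ?Y j x)"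
    if x: "R < norm x" for x
  proof -
    have hs: "h y $ j $ k = h y $ k $ j" if "R < norm y" for j k y
    proof -
      have "transpose (h y) $ j $ k = h y $ j $ k" using sym[of y] that R0 by simp
      then show ?thesis by (simp add: transpose_def)
    qed
    \<comment> \<open>Symmetry holds on an open set around \<open>x\<close>, so it passes to the
      partial derivatives.\<close>
    have "partial k (\<lambda>y. h y $ j $ k) x = partial k (\<lambda>y. h y $ k $ j) x" for j k
      by (rule partial_cong_open[OF open_norm_greater[of R]]) (use x hs in auto)
    \<comment> \<open>Symmetric against skew: exchanging the two indices turns the sum into its own
      negative.\<close>
    moreover have "(\<Sum>k\<in>UNIV. \<Sum>j\<in>UNIV. h x $ j $ k * M $ j $ k) = 0"
    proof -
      have "h x $ j $ k * M $ j $ k = - (h x $ k $ j * M $ k $ j)" for j k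
        using hs[OF x, of k j] M(2)[of k j] by simp
      then have "(\<Sum>k\<in>UNIV. \<Sum>j\<in>UNIV. h x $ j $ k * M $ j $ k) = (\<Sum>k\<in>UNIV. \<Sum>j\<in>UNIV. - (h x $ k $ j * M $ k $ j))"
        by (intro sum.cong refl)
      also have "\<dots> = - (\<Sum>j\<in>UNIV. \<Sum>k\<in>UNIV. h x $ k $ j * M $ k $ j)"
        unfolding sum_negf by (subst sum.swap) simp
      finally show ?thesis by simp
    qed
    ultimately show ?thesis
      by (simp add: V_partial[OF x] sum.distrib sum_distrib_right)
         (rule sum.swap)
  qed
  have divV_small: "(\<lambda>x. \<Sum>k\<in>UNIV. partial k (V k) x) \<in> o[at_infinity](\<lambda>x. norm x powr -p)"
  proof -
    have "(\<lambda>x. \<Sum>j\<in>UNIV. (\<Sum>k\<in>UNIV. partial k (\<lambda>y. h y $ k $ j) x) * ?Y j x) \<in> o[at_infinity](\<lambda>x. norm x powr (-p - 1) * norm x powr 1)"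
      by (intro big_sum_in_smallo landau_o.small_big_mult div Y)
    then have "(\<lambda>x. \<Sum>j\<in>UNIV. (\<Sum>k\<in>UNIV. partial k (\<lambda>y. h y $ k $ j) x) * ?Y j x) \<in> o[at_infinity](\<lambda>x. norm x powr -p)"
      by (simp only: powr_add[symmetric]) simp
    moreover have "eventually (\<lambda>x. (\<Sum>k\<in>UNIV. partial k (V k) x) = (\<Sum>j\<in>UNIV. (\<Sum>k\<in>UNIV. partial k (\<lambda>y. h y $ k $ j) x) * ?Y j x)) at_infinity"
      by (rule eventually_mono[OF eventually_norm_greater[of R]]) (rule divV)
    ultimately show ?thesis
      using landau_o.small.in_cong by fast
  qed

  have F_V: "F (spherical r s) = (\<Sum>k\<in>UNIV. V k (spherical r s) * spherical 1 s $ k)" if "R < r" for r s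
  proof -
    have "spherical r s $ k / norm (spherical r s) = spherical 1 s $ k" for k
      using that R0 by (subst (1) spherical_eq_scaleR) simp
    then show ?thesis
      unfolding F_def V_def by (simp only: sum_distrib_right) (rule sum.swap)
  qed
  have "(I has_real_derivative integral angles (\<lambda>s. r\<^sup>2 * sin (fst s) * (\<Sum>k\<in>UNIV. partial k (V k) (spherical r s)))) (at r)"
    if "R < r" for r
  proof (rule has_field_derivative_transform_within_open[OF flux_has_derivative[OF R0(1) that V_diff V_cont]])
    show "integral angles (\<lambda>s. \<rho>\<^sup>2 * sin (fst s) * (\<Sum>k\<in>UNIV. V k (spherical \<rho> s) * spherical 1 s $ k)) = I \<rho>"
      if "\<rho> \<in> {R<..}" for \<rho>
      using that by (simp add: I_def F_V)
  qed (use that in auto)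
  moreover have "(\<lambda>r. integral angles (\<lambda>s. r\<^sup>2 * sin (fst s) * (\<Sum>k\<in>UNIV. partial k (V k) (spherical r s))))
      \<in> o[at_top](\<lambda>r. r powr (3 - p - 1))"
    using sphere_integral_smallo[OF R0(1) _ divV_small] V_cont
    by (simp add: continuous_on_sum add.commute)
  moreover have "\<exists>A B. ((\<lambda>r. I r - A * r powr (3 - p)) \<longlongrightarrow> B) at_top"
    unfolding I_def
  proof (rule sphere_integral_expansion[OF _ R0(1),
      where W = W and b = "\<lambda>w. \<Sum>j\<in>UNIV. \<Sum>k\<in>UNIV. b w $ j $ k * ?Y j w * w $ k"
        and c = "\<lambda>w. \<Sum>j\<in>UNIV. \<Sum>k\<in>UNIV. c w $ j $ k * ?Y j w * w $ k"])
    show "continuous_on {x. R < norm x} F"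
      unfolding F_def[abs_def] by (intro continuous_on_sum continuous_on_mult h_cont Y_cont u_cont)
    show "continuous_on {x. R < norm x} W"
      unfolding W_def[abs_def] by (intro continuous_on_sum continuous_on_mult e_cont Y_cont u_cont)
    have "W \<in> o[at_infinity](\<lambda>x. norm x powr -3 * norm x powr 1 * 1)"
      unfolding W_def[abs_def]
      by (intro big_sum_in_smallo landau_o.small_big_mult smallo_derivD(1)[OF e] Y u)
    then show "W \<in> o[at_infinity](\<lambda>x. norm x powr -2)"
      by (simp only: powr_add[symmetric] mult_1_right) simp
    show "F x = norm x powr (3 - p - 2) * (\<Sum>j\<in>UNIV. \<Sum>k\<in>UNIV. b (x /\<^sub>R norm x) $ j $ k * ?Y j (x /\<^sub>R norm x) * (x /\<^sub>R norm x) $ k)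
        + norm x powr -2 * (\<Sum>j\<in>UNIV. \<Sum>k\<in>UNIV. c (x /\<^sub>R norm x) $ j $ k * ?Y j (x /\<^sub>R norm x) * (x /\<^sub>R norm x) $ k) + W x"
      if "R < norm x" for x
    proof -
      define w where "w = x /\<^sub>R norm x"
      have nx: "0 < norm x" using that R0 by linarith
      \<comment> \<open>The rotation field is homogeneous of degree one, which raises both exponents
        of the expansion by one: -p becomes m - 2, and -3 becomes -2, the power that the area
        element turns into a constant.\<close>
      have Yw: "?Y j x = norm x * ?Y j w" for j
        using nx by (simp add: w_def matrix_vector_mult_scaleR)
      have uw: "x $ k / norm x = w $ k" for k
        by (simp add: w_def divide_inverse mult.commute)
      have pw: "norm x * norm x powr -p = norm x powr (3 - p - 2)" "norm x * norm x powr -3 = norm x powr -2"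
        using nx by (simp_all add: powr_mult_base)
      have "h x $ j $ k * ?Y j x * (x $ k / norm x) =
          norm x powr (3 - p - 2) * (b w $ j $ k * ?Y j w * w $ k) + norm x powr -2 * (c w $ j $ k * ?Y j w * w $ k)
          + e j k x * ?Y j x * (x $ k / norm x)" for j k
        unfolding e_def w_def[symmetric] Yw uw pw[symmetric] by (simp add: algebra_simps)
      then show ?thesis
        unfolding F_def W_def w_def[symmetric] by (simp only: sum.distrib sum_distrib_left)
    qed
  qed (use p in auto)
  ultimately obtain B where "(I \<longlongrightarrow> B) at_top"
    using tendsto_if_derivative_smallo[of "3 - p" R I] p by fastforce
  then have "((\<lambda>r. 1 / (8 * pi) * I r) \<longlongrightarrow> 1 / (8 * pi) * B) at_top"
    by (rule tendsto_mult_left)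
  then have "(angular_momentum_at h (rotation_field l) \<longlongrightarrow> 1 / (8 * pi) * B) at_top"
  proof (rule Lim_transform_eventually)
    show "eventually (\<lambda>r. 1 / (8 * pi) * I r = angular_momentum_at h (rotation_field l) r) at_top"
    proof (rule eventually_mono[OF eventually_gt_at_top[of R]])
      fix r assume r: "R < r"
      have "continuous_on (sphere 0 r) F"
        unfolding F_def[abs_def]
        by (rule continuous_on_subset[of "{x. R < norm x}"],
            intro continuous_on_sum continuous_on_mult h_cont Y_cont u_cont) (use r in auto)
      from integral_sphere_measure[OF _ this] r R0
      have "(\<integral>x. F x \<partial>sphere_measure r) = I r"
        by (simp add: I_def)
      then show "1 / (8 * pi) * I r = angular_momentum_at h (rotation_field l) r"
        unfolding angular_momentum_at_def M F_def by simp
    qed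
  qed
  then show ?thesis ..
qed

section \<open>From an end of the manifold to its coordinates\<close>

theorem theorem1:
  fixes M :: "'a topology" and A :: "'a chart set" and g k :: "'a tensor2"
    and K :: "'a set" and \<Phi> :: "'a set \<Rightarrow> 'a \<Rightarrow> real^3"
    and q p \<epsilon> \<epsilon>' :: real
    and pi_bar pi_cub :: "'a set \<Rightarrow> real^3 \<Rightarrow> real^3^3"
  assumes "q > 1/2" and "3/2 < p" and "p < 3" and "\<epsilon> > 0" and "\<epsilon>' > 0"
    and "initial_data_set M A g k"
    and "asymptotically_flat q p \<epsilon> M A g k K \<Phi>"
    and "\<And>E. E \<in> ends M K \<Longrightarrow>
           momentum_expansion p (conj_momentum (g (E, \<Phi> E)) (k (E, \<Phi> E))) (pi_bar E) (pi_cub E)"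
    and "\<And>E. E \<in> ends M K \<Longrightarrow>
           covector_norm (g (E, \<Phi> E)) (current_density (g (E, \<Phi> E)) (k (E, \<Phi> E)))
             \<in> O[at_infinity](\<lambda>x. norm x powr (-4 - \<epsilon>'))"
  shows "\<forall>E\<in>ends M K. \<forall>i. \<exists>L::real.
           ((\<lambda>r. angular_momentum_at (conj_momentum (g (E, \<Phi> E)) (k (E, \<Phi> E))) (rotation_field i) r)
              \<longlongrightarrow> L) at_top"
proof (intro ballI allI)
  fix E l assume E: "E \<in> ends M K"
  define c where "c = (E, \<Phi> E)"
  from E assms(7) obtain C where c: "c \<in> A" and C: "compact C" "snd c ` fst c = - C"
    and af: "asymptotically_flat_coords q p \<epsilon> (g c) (k c)"
    unfolding asymptotically_flat_def c_def by auto
  \<comment> \<open>Symmetry of the components is known on the image of the chart only, which is the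
    complement of \<open>C\<close>; outside a ball containing \<open>C\<close> it is available
    everywhere.\<close>
  obtain R0 where R0: "\<And>x. x \<in> C \<Longrightarrow> norm x \<le> R0"
    using compact_imp_bounded[OF C(1)] unfolding bounded_iff by auto
  have dom: "x \<in> snd c ` fst c" if "R0 < norm x" for x
    using R0[of x] that by (auto simp: C(2))
  have "symmetric_tensor A (g :: 'a tensor2)" "symmetric_tensor A k"
    using assms(6) by (auto simp: initial_data_set_def riemannian_metric_def)
  then have "transpose (g c x) = g c x" "transpose (k c x) = k c x" if "R0 < norm x" for x
    using dom[OF that] c unfolding symmetric_tensor_def by blast+
  then have sym: "transpose (conj_momentum (g c) (k c) x) = conj_momentum (g c) (k c) x"
    if "R0 < norm x" for x
    using that by (simp add: conj_momentum_def transpose_def vec_eq_iff)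
  have q: "0 < q" using assms(1) by simp
  have g_flat: "bigO_deriv 2 (-q) (\<lambda>x. g c x $ i $ j - (if i = j then 1 else 0))"
    and k_decay: "bigO_deriv 1 (-p) (\<lambda>x. k c x $ i $ j)" for i j
    using af unfolding asymptotically_flat_coords_def by blast+
  \<comment> \<open>p < 3 enters here as -4 < -p - 1.\<close>
  have "(\<lambda>x::real^3. norm x powr (-4 - \<epsilon>')) \<in> o[at_infinity](\<lambda>x. norm x powr (-p - 1))"
    unfolding norm_powr_smallo_iff using assms(3,5) by simp
  then have J: "covector_norm (g c) (current_density (g c) (k c)) \<in> o[at_infinity](\<lambda>x. norm x powr (-p - 1))"
    using landau_o.big_small_trans[OF assms(9)[OF E]] unfolding c_def by blast
  show "\<exists>L. ((\<lambda>r. angular_momentum_at (conj_momentum (g (E, \<Phi> E)) (k (E, \<Phi> E))) (rotation_field l) r)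
              \<longlongrightarrow> L) at_top"
    using angular_momentum_converges[OF assms(3) conj_momentum_bigO_deriv[OF q g_flat k_decay] sym
        flat_divergence_smallo[OF q g_flat k_decay J] assms(8)[OF E, folded c_def]]
    unfolding c_def .
qed

end
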